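(* Setting: $n$ agents on a connected, undirected weighted graph $\mathcal G$ with symmetric adjacency weights $a_{i,j}$ ($a_{i,j}>0$ iff $\{i,j\}$ is an edge, else $0$) and Laplacian $L_n$; $L=L_n\otimes I_m$. For each $i$, $\Omega_i\subset\mathbb R^{q_i}$ is closed and convex, $f^i$ is strictly convex on an open set containing $\Omega_i$, $W_i\in\mathbb R^{m\times q_i}$, $d_i\in\mathbb R^m$ with $\sum_id_i=d_0$; $\Omega=\prod_i\Omega_i$, $f(x)=\sum_if^i(x_i)$, $W=[W_1,\dots,W_n]$; and Slater's condition holds (some $x$ in the interior of $\Omega$ has $Wx=d_0$). Consider the problem $\min f(x)$ s.t. $\sum_iW_ix_i=d_0$, $x_i\in\Omega_i$, and the algorithm (for $i=1,\dots,n$, $t\ge0$, arbitrary initial $y_i(0)\in\mathbb R^{q_i}$, $\lambda_i(0),z_i(0)\in\mathbb R^m$) $$\dot y_i\in\{-y_i+x_i-g_i+W_i^{\rm T}\lambda_i:\ g_i\in\partial f^i(x_i)\},$$ $$\dot\lambda_i=d_i-W_ix_i-\sum_{j}a_{i,j}(\lambda_i-\lambda_j)-\sum_ja_{i,j}(z_i-z_j),\qquad \dot z_i=\sum_ja_{i,j}(\lambda_i-\lambda_j),\qquad x_i=P_{\Omega_i}(y_i).$$ Then (i) every solution $(y(t),x(t),\lambda(t),z(t))$ is bounded; (ii) for every solution, $x(t)=[x_1(t)^{\rm T},\dots,x_n(t)^{\rm T}]^{\rm T}$ converges to the optimal solution of the problem as $t\to\infty$.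
   Context: $\partial f^i$ is the convex subdifferential; $P_{\Omega_i}$ is Euclidean projection onto $\Omega_i$. A solution is an absolutely continuous function on $[0,\infty)$ satisfying the inclusion/equations for almost all $t$ (solutions are assumed to exist on $[0,\infty)$).
   Formalization: The existence of an optimal solution is assumed explicitly; without it claim (i) fails and (ii) has no meaning (e.g. n=1, Ω=ℝ, f=exp, W=0, d=0 gives y'=-e^y, which is unbounded). *)

theory Defs
  imports "HOL-Analysis.Analysis"
begin

text \<open>Vectors of \<real>^k are encoded as functions nat \<Rightarrow> real vanishing at indices \<ge> k.
  Matrices in \<real>^(r\<times>c) are functions nat \<Rightarrow> nat \<Rightarrow> real (row, column).\<close>

definition vecs :: "nat \<Rightarrow> (nat \<Rightarrow> real) set" where
  "vecs k = {v. \<forall>j\<ge>k. v j = 0}"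

definition vinner :: "nat \<Rightarrow> (nat \<Rightarrow> real) \<Rightarrow> (nat \<Rightarrow> real) \<Rightarrow> real" where
  "vinner k u v = (\<Sum>j<k. u j * v j)"

definition vnorm :: "nat \<Rightarrow> (nat \<Rightarrow> real) \<Rightarrow> real" where
  "vnorm k v = sqrt (\<Sum>j<k. (v j)^2)"

definition mat_vec :: "nat \<Rightarrow> nat \<Rightarrow> (nat \<Rightarrow> nat \<Rightarrow> real) \<Rightarrow> (nat \<Rightarrow> real) \<Rightarrow> (nat \<Rightarrow> real)" where
  "mat_vec r c M v = (\<lambda>i. if i < r then (\<Sum>j<c. M i j * v j) else 0)"

definition matT_vec :: "nat \<Rightarrow> nat \<Rightarrow> (nat \<Rightarrow> nat \<Rightarrow> real) \<Rightarrow> (nat \<Rightarrow> real) \<Rightarrow> (nat \<Rightarrow> real)" where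
  "matT_vec r c M w = (\<lambda>j. if j < c then (\<Sum>i<r. M i j * w i) else 0)"

definition convex_vec :: "(nat \<Rightarrow> real) set \<Rightarrow> bool" where
  "convex_vec S \<longleftrightarrow> (\<forall>u\<in>S. \<forall>v\<in>S. \<forall>s::real. 0 \<le> s \<and> s \<le> 1 \<longrightarrow>
      (\<lambda>j. s * u j + (1 - s) * v j) \<in> S)"

definition strict_convex_vec_on :: "(nat \<Rightarrow> real) set \<Rightarrow> ((nat \<Rightarrow> real) \<Rightarrow> real) \<Rightarrow> bool" where
  "strict_convex_vec_on S f \<longleftrightarrow> (\<forall>u\<in>S. \<forall>v\<in>S. \<forall>s::real. u \<noteq> v \<and> 0 < s \<and> s < 1 \<longrightarrow>
      f (\<lambda>j. s * u j + (1 - s) * v j) < s * f u + (1 - s) * f v)"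

definition subdiff :: "nat \<Rightarrow> (nat \<Rightarrow> real) set \<Rightarrow> ((nat \<Rightarrow> real) \<Rightarrow> real) \<Rightarrow> (nat \<Rightarrow> real) \<Rightarrow> (nat \<Rightarrow> real) set" where
  "subdiff k U f x = {g \<in> vecs k. \<forall>z\<in>U. f z \<ge> f x + vinner k g (\<lambda>j. z j - x j)}"

definition is_proj :: "nat \<Rightarrow> (nat \<Rightarrow> real) set \<Rightarrow> (nat \<Rightarrow> real) \<Rightarrow> (nat \<Rightarrow> real) \<Rightarrow> bool" where
  "is_proj k S y p \<longleftrightarrow> p \<in> S \<and> (\<forall>z\<in>S. vnorm k (\<lambda>j. y j - p j) \<le> vnorm k (\<lambda>j. y j - z j))"

definition abs_cont_on :: "real set \<Rightarrow> (real \<Rightarrow> real) \<Rightarrow> bool" where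
  "abs_cont_on S f \<longleftrightarrow> (\<forall>\<epsilon>>0. \<exists>\<delta>>0. \<forall>(N::nat) (a::nat \<Rightarrow> real) b.
      (\<forall>k<N. a k \<in> S \<and> b k \<in> S \<and> a k \<le> b k) \<and>
      (\<forall>k<N. \<forall>l<N. k \<noteq> l \<longrightarrow> b k \<le> a l \<or> b l \<le> a k) \<and>
      (\<Sum>k<N. b k - a k) < \<delta> \<longrightarrow> (\<Sum>k<N. \<bar>f (b k) - f (a k)\<bar>) < \<epsilon>)"

definition abs_cont_nonneg :: "(real \<Rightarrow> real) \<Rightarrow> bool" where
  "abs_cont_nonneg f \<longleftrightarrow> (\<forall>T\<ge>0. abs_cont_on {0..T} f)"

definition graph_connected :: "nat \<Rightarrow> (nat \<Rightarrow> nat \<Rightarrow> real) \<Rightarrow> bool" where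
  "graph_connected n a \<longleftrightarrow> (\<forall>i<n. \<forall>j<n. (\<lambda>u v. u < n \<and> v < n \<and> a u v > 0)\<^sup>*\<^sup>* i j)"

definition feasible :: "nat \<Rightarrow> nat \<Rightarrow> (nat \<Rightarrow> nat) \<Rightarrow> (nat \<Rightarrow> (nat \<Rightarrow> real) set)
    \<Rightarrow> (nat \<Rightarrow> nat \<Rightarrow> nat \<Rightarrow> real) \<Rightarrow> (nat \<Rightarrow> nat \<Rightarrow> real) \<Rightarrow> (nat \<Rightarrow> nat \<Rightarrow> real) \<Rightarrow> bool" where
  "feasible n m q \<Omega> W d x \<longleftrightarrow> (\<forall>i<n. x i \<in> \<Omega> i) \<and>
     (\<forall>r<m. (\<Sum>i<n. mat_vec m (q i) (W i) (x i) r) = (\<Sum>i<n. d i r))"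

definition optimal :: "nat \<Rightarrow> nat \<Rightarrow> (nat \<Rightarrow> nat) \<Rightarrow> (nat \<Rightarrow> (nat \<Rightarrow> real) set)
    \<Rightarrow> (nat \<Rightarrow> (nat \<Rightarrow> real) \<Rightarrow> real)
    \<Rightarrow> (nat \<Rightarrow> nat \<Rightarrow> nat \<Rightarrow> real) \<Rightarrow> (nat \<Rightarrow> nat \<Rightarrow> real) \<Rightarrow> (nat \<Rightarrow> nat \<Rightarrow> real) \<Rightarrow> bool" where
  "optimal n m q \<Omega> f W d x \<longleftrightarrow> feasible n m q \<Omega> W d x \<and>
     (\<forall>x'. feasible n m q \<Omega> W d x' \<longrightarrow> (\<Sum>i<n. f i (x i)) \<le> (\<Sum>i<n. f i (x' i)))"

end

theory Submission
  imports Defs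
begin

text \<open>Given an optimal point \<open>xs\<close>, Slater's condition yields a multiplier \<open>\<mu>\<close> such that \<open>xs i\<close>
  minimises \<open>f i u - \<langle>W i\<^sup>T \<mu>, u\<rangle>\<close> over \<open>\<Omega> i\<close>, and connectedness of the graph yields \<open>zs\<close> whose
  Laplacian is \<open>d - W xs\<close>. Along a solution the Lyapunov function
  \<open>1/2 (|y - xs|\<^sup>2 - |y - x|\<^sup>2 + |lam - \<mu>|\<^sup>2 + |z - zs|\<^sup>2)\<close> dominates
  \<open>1/2 (|x - xs|\<^sup>2 + |lam - \<mu>|\<^sup>2 + |z - zs|\<^sup>2)\<close> and decreases at least at the rate of the Lagrangian
  gap of \<open>x\<close>. Hence \<open>x\<close>, \<open>lam\<close>, \<open>z\<close> are bounded; subgradients are bounded on compact subsets of \<open>U\<close>,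
  so \<open>y\<close> is bounded and Lipschitz, and so is its projection \<open>x\<close>. By strict convexity the gap is
  bounded away from zero off any neighbourhood of \<open>xs\<close>, which forces \<open>x\<close> to converge to \<open>xs\<close>.\<close>

subsection \<open>Absolutely continuous functions\<close>

text \<open>A plain square in \<open>y\<close> would pair the dynamics with a deviation of
  \<open>y\<close>, whereas the subgradient inequality and the coupling through \<open>W\<close>
  speak about \<open>x - xs\<close>. Subtracting \<open>|y - x|\<^sup>2\<close> yields a function of
  \<open>y\<close> with gradient \<open>x - xs\<close>, even where the projection is not
  differentiable. The price is that the energy controls \<open>x\<close> but not \<open>y\<close>;
  for \<open>y\<close> one uses the damping term \<open>-y\<close> of its own equation, once all
  other terms in it are known to be bounded.

  The derivative exists only almost everywhere and the subgradients along a solution carry no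
  continuity or measurability, so no integral is formed. Every estimate in time rests on one fact:
  an absolutely continuous function with nonpositive derivative almost everywhere does not increase.
  For the same reason the final limit is reached by counting drops of the energy rather than by an
  invariance principle.

  The multiplier theorem serves twice: for the constrained problem itself, and as a Fredholm
  alternative for the Laplacian system that defines \<open>zs\<close>.\<close>

lemma abs_cont_onD:
  assumes "abs_cont_on S f" "\<epsilon> > 0"
  shows "\<exists>\<delta>>0. \<forall>(I :: 'i set) l u. finite I \<longrightarrow> (\<forall>k\<in>I. l k \<in> S \<and> u k \<in> S \<and> l k \<le> u k) \<longrightarrow>
      (\<forall>k\<in>I. \<forall>k'\<in>I. k \<noteq> k' \<longrightarrow> u k \<le> l k' \<or> u k' \<le> l k) \<longrightarrow>
      (\<Sum>k\<in>I. u k - l k) < \<delta> \<longrightarrow> (\<Sum>k\<in>I. \<bar>f (u k) - f (l k)\<bar>) < \<epsilon>"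
proof -
  obtain \<delta> where \<delta>: "\<delta> > 0" and *: "\<forall>(N::nat) (a::nat \<Rightarrow> real) b.
      (\<forall>k<N. a k \<in> S \<and> b k \<in> S \<and> a k \<le> b k) \<and>
      (\<forall>k<N. \<forall>l<N. k \<noteq> l \<longrightarrow> b k \<le> a l \<or> b l \<le> a k) \<and>
      (\<Sum>k<N. b k - a k) < \<delta> \<longrightarrow> (\<Sum>k<N. \<bar>f (b k) - f (a k)\<bar>) < \<epsilon>"
    using assms(1)[unfolded abs_cont_on_def] assms(2) by blast
  show ?thesis
  proof (intro exI[of _ \<delta>] conjI allI impI \<delta>)
    fix I :: "'i set" and l u
    assume fin: "finite I" and mem: "\<forall>k\<in>I. l k \<in> S \<and> u k \<in> S \<and> l k \<le> u k"
      and dis: "\<forall>k\<in>I. \<forall>k'\<in>I. k \<noteq> k' \<longrightarrow> u k \<le> l k' \<or> u k' \<le> l k"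
      and len: "(\<Sum>k\<in>I. u k - l k) < \<delta>"
    \<comment> \<open>Arbitrary finite index sets are wanted because the covering argument indexes
      its intervals by pairs of a tag and a cell; an enumeration reduces them to the index range of
      the definition.\<close>
    obtain h where h: "bij_betw h {0..<card I} I"
      using ex_bij_betw_nat_finite[OF fin] by blast
    then have h': "bij_betw h {..<card I} I" by (simp add: atLeast0LessThan)
    have hI: "h k \<in> I" if "k < card I" for k
      using h' that by (auto simp: bij_betw_def)
    have hinj: "h k \<noteq> h l" if "k < card I" "l < card I" "k \<noteq> l" for k l
      using h' that by (auto simp: bij_betw_def inj_on_def)
    have "(\<Sum>k<card I. \<bar>f (u (h k)) - f (l (h k))\<bar>) < \<epsilon>"
    proof (rule *[rule_format], intro conjI allI impI)
      show "(\<Sum>k<card I. u (h k) - l (h k)) < \<delta>"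
        using len sum.reindex_bij_betw[OF h', of "\<lambda>k. u k - l k"] by simp
    qed (use hI hinj mem dis in auto)
    then show "(\<Sum>k\<in>I. \<bar>f (u k) - f (l k)\<bar>) < \<epsilon>"
      using sum.reindex_bij_betw[OF h', of "\<lambda>k. \<bar>f (u k) - f (l k)\<bar>"] by simp
  qed
qed

lemma abs_cont_on_subset:
  assumes "abs_cont_on S f" "T \<subseteq> S"
  shows "abs_cont_on T f"
  unfolding abs_cont_on_def
proof (intro allI impI)
  fix \<epsilon> :: real assume "\<epsilon> > 0"
  then obtain \<delta> where \<delta>: "\<delta> > 0" and D: "\<forall>(N::nat) (a::nat \<Rightarrow> real) b.
      (\<forall>k<N. a k \<in> S \<and> b k \<in> S \<and> a k \<le> b k) \<and>
      (\<forall>k<N. \<forall>l<N. k \<noteq> l \<longrightarrow> b k \<le> a l \<or> b l \<le> a k) \<and>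
      (\<Sum>k<N. b k - a k) < \<delta> \<longrightarrow> (\<Sum>k<N. \<bar>f (b k) - f (a k)\<bar>) < \<epsilon>"
    using assms(1)[unfolded abs_cont_on_def] by blast
  show "\<exists>\<delta>>0. \<forall>(N::nat) (a::nat \<Rightarrow> real) b.
      (\<forall>k<N. a k \<in> T \<and> b k \<in> T \<and> a k \<le> b k) \<and>
      (\<forall>k<N. \<forall>l<N. k \<noteq> l \<longrightarrow> b k \<le> a l \<or> b l \<le> a k) \<and>
      (\<Sum>k<N. b k - a k) < \<delta> \<longrightarrow> (\<Sum>k<N. \<bar>f (b k) - f (a k)\<bar>) < \<epsilon>"
  proof (intro exI[of _ \<delta>] conjI allI impI \<delta>)
    fix N :: nat and a b :: "nat \<Rightarrow> real"
    assume "(\<forall>k<N. a k \<in> T \<and> b k \<in> T \<and> a k \<le> b k) \<and>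
      (\<forall>k<N. \<forall>l<N. k \<noteq> l \<longrightarrow> b k \<le> a l \<or> b l \<le> a k) \<and> (\<Sum>k<N. b k - a k) < \<delta>"
    then show "(\<Sum>k<N. \<bar>f (b k) - f (a k)\<bar>) < \<epsilon>"
      using D[THEN spec, of N, THEN spec, of a, THEN spec, of b] assms(2) by blast
  qed
qed

lemma abs_cont_on_id: "abs_cont_on S (\<lambda>t. t)"
  unfolding abs_cont_on_def
proof (intro allI impI)
  fix \<epsilon> :: real assume "\<epsilon> > 0"
  show "\<exists>\<delta>>0. \<forall>N a b. (\<forall>k<N. a k \<in> S \<and> b k \<in> S \<and> a k \<le> b k) \<and>
      (\<forall>k<N. \<forall>l<N. k \<noteq> l \<longrightarrow> b k \<le> a l \<or> b l \<le> a k) \<and>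
      (\<Sum>k<(N::nat). b k - a k) < \<delta> \<longrightarrow> (\<Sum>k<N. \<bar>b k - a k\<bar>) < \<epsilon>"
  proof (intro exI[of _ \<epsilon>] conjI allI impI \<open>\<epsilon> > 0\<close>)
    fix N :: nat and a b :: "nat \<Rightarrow> real"
    assume H: "(\<forall>k<N. a k \<in> S \<and> b k \<in> S \<and> a k \<le> b k) \<and>
      (\<forall>k<N. \<forall>l<N. k \<noteq> l \<longrightarrow> b k \<le> a l \<or> b l \<le> a k) \<and> (\<Sum>k<N. b k - a k) < \<epsilon>"
    have "(\<Sum>k<N. \<bar>b k - a k\<bar>) = (\<Sum>k<N. b k - a k)"
      using H by (intro sum.cong) auto
    with H show "(\<Sum>k<N. \<bar>b k - a k\<bar>) < \<epsilon>" by simp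
  qed
qed

text \<open>The common source of the closure properties below: sums, products, Lipschitz functions
  and the projection energy all have increments dominated by those of known functions.\<close>

lemma abs_cont_on_dominated:
  fixes F :: "'i \<Rightarrow> real \<Rightarrow> real"
  assumes fin: "finite K" and ac: "\<And>k. k \<in> K \<Longrightarrow> abs_cont_on S (F k)"
    and dom: "\<And>u v. u \<in> S \<Longrightarrow> v \<in> S \<Longrightarrow> \<bar>G v - G u\<bar> \<le> C * (\<Sum>k\<in>K. \<bar>F k v - F k u\<bar>)"
  shows "abs_cont_on S G"
  unfolding abs_cont_on_def
proof (intro allI impI)
  fix \<epsilon> :: real assume \<epsilon>: "\<epsilon> > 0"
  \<comment> \<open>The two summands 1 keep the denominator positive when \<open>C = 0\<close> or
    \<open>K\<close> is empty, and make the final estimate strict.\<close>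
  define \<eta> where "\<eta> = \<epsilon> / ((\<bar>C\<bar> + 1) * (real (card K) + 1))"
  have \<eta>: "\<eta> > 0" unfolding \<eta>_def using \<epsilon> by (intro divide_pos_pos mult_pos_pos) auto
  define P where "P k \<delta> \<longleftrightarrow> (\<forall>(N::nat) (a::nat \<Rightarrow> real) b.
      (\<forall>k<N. a k \<in> S \<and> b k \<in> S \<and> a k \<le> b k) \<and>
      (\<forall>k<N. \<forall>l<N. k \<noteq> l \<longrightarrow> b k \<le> a l \<or> b l \<le> a k) \<and>
      (\<Sum>k<N. b k - a k) < \<delta> \<longrightarrow> (\<Sum>j<N. \<bar>F k (b j) - F k (a j)\<bar>) < \<eta>)" for k \<delta>
  have "\<exists>\<delta>>0. P k \<delta>" if "k \<in> K" for k
    unfolding P_def using ac[OF that, unfolded abs_cont_on_def] \<eta> by (elim allE[of _ \<eta>] impE) auto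
  then obtain \<delta> where \<delta>: "\<And>k. k \<in> K \<Longrightarrow> \<delta> k > 0" and
    D: "\<And>k. k \<in> K \<Longrightarrow> P k (\<delta> k)"
    by metis
  show "\<exists>\<delta>>0. \<forall>(N::nat) a b. (\<forall>k<N. a k \<in> S \<and> b k \<in> S \<and> a k \<le> b k) \<and>
      (\<forall>k<N. \<forall>l<N. k \<noteq> l \<longrightarrow> b k \<le> a l \<or> b l \<le> a k) \<and>
      (\<Sum>k<N. b k - a k) < \<delta> \<longrightarrow> (\<Sum>k<N. \<bar>G (b k) - G (a k)\<bar>) < \<epsilon>"
  proof (intro exI[of _ "Min (insert 1 (\<delta> ` K))"] conjI allI impI)
    show "0 < Min (insert 1 (\<delta> ` K))" using fin \<delta> by auto
    fix N :: nat and a b :: "nat \<Rightarrow> real"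
    assume H: "(\<forall>k<N. a k \<in> S \<and> b k \<in> S \<and> a k \<le> b k) \<and>
      (\<forall>k<N. \<forall>l<N. k \<noteq> l \<longrightarrow> b k \<le> a l \<or> b l \<le> a k) \<and>
      (\<Sum>k<N. b k - a k) < Min (insert 1 (\<delta> ` K))"
    have each: "(\<Sum>j<N. \<bar>F k (b j) - F k (a j)\<bar>) \<le> \<eta>" if "k \<in> K" for k
    proof -
      have "Min (insert 1 (\<delta> ` K)) \<le> \<delta> k" using fin that by auto
      with H have "(\<Sum>k<N. b k - a k) < \<delta> k" by linarith
      with H show ?thesis using D[OF that, unfolded P_def] by (blast intro: less_imp_le)
    qed
    have "(\<Sum>j<N. \<bar>G (b j) - G (a j)\<bar>) \<le> (\<Sum>j<N. C * (\<Sum>k\<in>K. \<bar>F k (b j) - F k (a j)\<bar>))"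
      using H by (intro sum_mono dom) auto
    also have "\<dots> = C * (\<Sum>k\<in>K. \<Sum>j<N. \<bar>F k (b j) - F k (a j)\<bar>)"
      by (simp add: sum_distrib_left[symmetric] sum.swap[of _ K])
    also have "\<dots> \<le> \<bar>C\<bar> * (\<Sum>k\<in>K. \<Sum>j<N. \<bar>F k (b j) - F k (a j)\<bar>)"
      by (intro mult_right_mono sum_nonneg) auto
    also have "\<dots> \<le> \<bar>C\<bar> * (\<Sum>k\<in>K. \<eta>)"
      by (intro mult_left_mono sum_mono each) auto
    also have "\<dots> = \<bar>C\<bar> * card K * \<eta>" by simp
    also have "\<dots> < (\<bar>C\<bar> + 1) * (real (card K) + 1) * \<eta>"
      using \<eta> by (intro mult_strict_right_mono) (auto simp: algebra_simps add_nonneg_pos)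
    also have "\<dots> = \<epsilon>" unfolding \<eta>_def
      by (smt (verit, del_insts) mult_pos_pos nonzero_mult_div_cancel_left of_nat_0_le_iff times_divide_eq_right)
    finally show "(\<Sum>k<N. \<bar>G (b k) - G (a k)\<bar>) < \<epsilon>" .
  qed
qed

lemma abs_cont_on_imp_continuous_on:
  assumes "abs_cont_on {a..b} f"
  shows "continuous_on {a..b} f"
  unfolding continuous_on_iff
proof (intro ballI allI impI)
  fix x \<epsilon> :: real assume x: "x \<in> {a..b}" and "0 < \<epsilon>"
  \<comment> \<open>Continuity is the case of a single interval, hence the one-point index
    type.\<close>
  obtain \<delta> where \<delta>: "\<delta> > 0" and
    D: "\<forall>(I :: unit set) l u. finite I \<longrightarrow> (\<forall>k\<in>I. l k \<in> {a..b} \<and> u k \<in> {a..b} \<and> l k \<le> u k) \<longrightarrow>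
      (\<forall>k\<in>I. \<forall>k'\<in>I. k \<noteq> k' \<longrightarrow> u k \<le> l k' \<or> u k' \<le> l k) \<longrightarrow>
      (\<Sum>k\<in>I. u k - l k) < \<delta> \<longrightarrow> (\<Sum>k\<in>I. \<bar>f (u k) - f (l k)\<bar>) < \<epsilon>"
    using abs_cont_onD[OF assms \<open>0 < \<epsilon>\<close>] by (elim exE conjE)
  show "\<exists>d>0. \<forall>x'\<in>{a..b}. dist x' x < d \<longrightarrow> dist (f x') (f x) < \<epsilon>"
  proof (intro exI[of _ \<delta>] conjI ballI impI \<delta>)
    fix x' assume x': "x' \<in> {a..b}" "dist x' x < \<delta>"
    show "dist (f x') (f x) < \<epsilon>"
      using D[rule_format, of UNIV "\<lambda>_. min x x'" "\<lambda>_. max x x'"] x x'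
      by (cases "x \<le> x'") (auto simp: dist_real_def min_def max_def abs_minus_commute UNIV_unit)
  qed
qed

lemma abs_cont_on_bounded:
  assumes "abs_cont_on {a..b} f"
  obtains B where "B \<ge> 0" "\<And>t. t \<in> {a..b} \<Longrightarrow> \<bar>f t\<bar> \<le> B"
proof -
  have "bounded (f ` {a..b})"
    using assms abs_cont_on_imp_continuous_on compact_continuous_image compact_imp_bounded by blast
  then obtain B where "\<And>t. t \<in> {a..b} \<Longrightarrow> \<bar>f t\<bar> \<le> B"
    unfolding bounded_iff by (metis imageI real_norm_def)
  then show ?thesis using that[of "max 0 B"] by fastforce
qed

lemma abs_cont_on_sum:
  fixes F :: "'i \<Rightarrow> real \<Rightarrow> real"
  assumes "finite K" "\<And>k. k \<in> K \<Longrightarrow> abs_cont_on S (F k)"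
  shows "abs_cont_on S (\<lambda>t. \<Sum>k\<in>K. F k t)"
proof (rule abs_cont_on_dominated[OF assms, where C = 1])
  show "\<bar>(\<Sum>k\<in>K. F k v) - (\<Sum>k\<in>K. F k u)\<bar> \<le> 1 * (\<Sum>k\<in>K. \<bar>F k v - F k u\<bar>)" for u v
    by (simp add: sum_subtractf[symmetric] sum_abs)
qed

lemma abs_cont_on_const: "abs_cont_on S (\<lambda>_. c)"
  by (rule abs_cont_on_dominated[where K = "{}" and C = 0]) auto

lemma abs_cont_on_lipschitz:
  assumes "\<And>u v. u \<in> S \<Longrightarrow> v \<in> S \<Longrightarrow> \<bar>G v - G u\<bar> \<le> C * \<bar>v - u\<bar>"
  shows "abs_cont_on S G"
  by (rule abs_cont_on_dominated[where K = "{()}" and F = "\<lambda>_ t. t" and C = C])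
    (use assms abs_cont_on_id in auto)

lemma abs_cont_on_add:
  assumes "abs_cont_on S f" "abs_cont_on S g"
  shows "abs_cont_on S (\<lambda>t. f t + g t)"
  by (rule abs_cont_on_dominated[where K = "UNIV :: bool set" and F = "\<lambda>b. if b then f else g" and C = 1])
    (use assms in \<open>auto simp: UNIV_bool\<close>)

lemma abs_cont_on_mult:
  assumes f: "abs_cont_on {a..b} f" and g: "abs_cont_on {a..b} g"
  shows "abs_cont_on {a..b} (\<lambda>t. f t * g t)"
proof -
  obtain A where A: "A \<ge> 0" "\<And>t. t \<in> {a..b} \<Longrightarrow> \<bar>f t\<bar> \<le> A"
    using abs_cont_on_bounded[OF f] by blast
  obtain B where B: "B \<ge> 0" "\<And>t. t \<in> {a..b} \<Longrightarrow> \<bar>g t\<bar> \<le> B"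
    using abs_cont_on_bounded[OF g] by blast
  show ?thesis
  proof (rule abs_cont_on_dominated[where K = "UNIV :: bool set" and F = "\<lambda>b. if b then f else g" and C = "A + B"])
    fix u v assume uv: "u \<in> {a..b}" "v \<in> {a..b}"
    have "f v * g v - f u * g u = (f v - f u) * g v + f u * (g v - g u)"
      by (simp add: algebra_simps)
    then have "\<bar>f v * g v - f u * g u\<bar> \<le> \<bar>f v - f u\<bar> * \<bar>g v\<bar> + \<bar>f u\<bar> * \<bar>g v - g u\<bar>"
      by (metis abs_mult abs_triangle_ineq)
    also have "\<dots> \<le> \<bar>f v - f u\<bar> * (A + B) + (A + B) * \<bar>g v - g u\<bar>"
      using A(1) B(1) A(2)[OF uv(1)] B(2)[OF uv(2)] by (intro add_mono mult_mono) auto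
    finally show "\<bar>f v * g v - f u * g u\<bar> \<le> (A + B) *
        (\<Sum>k\<in>UNIV. \<bar>(if k then f else g) v - (if k then f else g) u\<bar>)"
      by (simp add: UNIV_bool algebra_simps)
  qed (use f g in auto)
qed

section \<open>Monotonicity from a derivative known almost everywhere\<close>

lemma has_real_derivative_increment_le:
  fixes f :: "real \<Rightarrow> real"
  assumes "(f has_real_derivative D) (at t)" "D \<le> 0" "\<epsilon> > 0"
  obtains r where "r > 0"
    and "\<And>u v. u \<le> t \<Longrightarrow> t \<le> v \<Longrightarrow> \<bar>u - t\<bar> < r \<Longrightarrow> \<bar>v - t\<bar> < r \<Longrightarrow> f v - f u \<le> \<epsilon> * (v - u)"
proof -
  have "(f has_derivative (*) D) (at t)"
    using assms(1) by (simp add: has_field_derivative_def)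
  then obtain r where r: "r > 0" and
    R: "\<And>y. norm (y - t) < r \<Longrightarrow> norm (f y - f t - D * (y - t)) \<le> \<epsilon> * norm (y - t)"
    unfolding has_derivative_at_alt using \<open>\<epsilon> > 0\<close> by blast
  show ?thesis
  proof (rule that[OF r])
    \<comment> \<open>The straddle estimate: since \<open>t\<close> lies between \<open>u\<close>
      and \<open>v\<close>, the two errors \<open>\<epsilon> * (v - t)\<close> and
      \<open>\<epsilon> * (t - u)\<close> add up to \<open>\<epsilon> * (v - u)\<close>.\<close>
    fix u v assume uv: "u \<le> t" "t \<le> v" "\<bar>u - t\<bar> < r" "\<bar>v - t\<bar> < r"
    have 1: "f v - f t - D * (v - t) \<le> \<epsilon> * (v - t)"
      using R[of v] uv by auto
    have 2: "f t - f u - D * (t - u) \<le> \<epsilon> * (t - u)"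
      using R[of u] uv by (auto simp: algebra_simps abs_le_iff)
    have "D * (v - u) \<le> 0" using uv \<open>D \<le> 0\<close> by (simp add: mult_nonpos_nonneg)
    then show "f v - f u \<le> \<epsilon> * (v - u)" using 1 2 by (simp add: algebra_simps)
  qed
qed

text \<open>A Cousin-type covering argument: intervals tagged in the exceptional null set have small
  total length, so they contribute little by absolute continuity; on all the others the
  increment is controlled by the derivative at the tag.\<close>

lemma abs_cont_on_nonincreasing:
  fixes G :: "real \<Rightarrow> real"
  assumes ab: "a \<le> b" and ac: "abs_cont_on {a..b} G"
    and ae: "AE t in lborel. a < t \<and> t < b \<longrightarrow> (\<exists>D\<le>0. (G has_real_derivative D) (at t))"
  shows "G b \<le> G a"
proof -
  have "G b - G a \<le> \<epsilon> * (1 + (b - a))" if \<epsilon>: "\<epsilon> > 0" for \<epsilon>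
  proof -
    obtain N0 where N0: "{t \<in> space lborel. \<not> (a < t \<and> t < b \<longrightarrow> (\<exists>D\<le>0. (G has_real_derivative D) (at t)))} \<subseteq> N0"
      "emeasure lborel N0 = 0" "N0 \<in> sets lborel"
      using AE_E[OF ae] by blast
    \<comment> \<open>The hypothesis speaks of the open interval only, so the endpoints join the
      exceptional set.\<close>
    define N where "N = N0 \<union> {a, b}"
    have N: "N \<in> sets borel" "emeasure lborel N = 0"
    proof -
      show "N \<in> sets borel" unfolding N_def using N0(3) by auto
      have "emeasure lborel N \<le> emeasure lborel N0 + emeasure lborel {a, b}"
        unfolding N_def by (intro emeasure_subadditive) (use N0 in auto)
      also have "\<dots> = 0" using N0 by (simp add: emeasure_lborel_countable)
      finally show "emeasure lborel N = 0" by simp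
    qed
    have der: "\<exists>D\<le>0. (G has_real_derivative D) (at t)" if "t \<in> {a..b}" "t \<notin> N" for t
    proof -
      have "a < t \<and> t < b" using that unfolding N_def by auto
      then show ?thesis using that N0(1) unfolding N_def by auto
    qed
    obtain \<delta> where \<delta>: "\<delta> > 0" and
      D: "\<forall>(I :: (real \<times> real set) set) l u. finite I \<longrightarrow> (\<forall>k\<in>I. l k \<in> {a..b} \<and> u k \<in> {a..b} \<and> l k \<le> u k) \<longrightarrow>
      (\<forall>k\<in>I. \<forall>k'\<in>I. k \<noteq> k' \<longrightarrow> u k \<le> l k' \<or> u k' \<le> l k) \<longrightarrow>
      (\<Sum>k\<in>I. u k - l k) < \<delta> \<longrightarrow> (\<Sum>k\<in>I. \<bar>G (u k) - G (l k)\<bar>) < \<epsilon>"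
      using abs_cont_onD[OF ac \<epsilon>] by (elim exE conjE)
    \<comment> \<open>Outer regularity supplies an open superset whose measure is below the
      threshold \<open>\<delta>\<close> of absolute continuity.\<close>
    obtain O' where O': "open O'" "N \<subseteq> O'" "emeasure lborel (O' - N) < \<delta>"
      using outer_regular_lborel[OF N(1) \<delta>] by blast
    have emO: "emeasure lborel O' < \<delta>"
    proof -
      have "emeasure lborel O' \<le> emeasure lborel (O' - N) + emeasure lborel N"
        using O' N emeasure_subadditive[of "O' - N" lborel N] by (simp add: Un_absorb2)
      then show ?thesis using O' N by simp
    qed
    \<comment> \<open>The gauge: a cell tagged in \<open>N\<close> is confined to \<open>O'\<close>,
      any other cell must obey the straddle estimate at its tag.\<close>
    have "\<exists>r>0. if t \<in> N then ball t r \<subseteq> O' else t \<in> {a..b} \<longrightarrow> (\<forall>u v. u \<le> t \<longrightarrow> t \<le> v \<longrightarrow> \<bar>u - t\<bar> < r \<longrightarrow> \<bar>v - t\<bar> < r \<longrightarrow> G v - G u \<le> \<epsilon> * (v - u))" for t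
    proof (cases "t \<in> N")
      case True
      then show ?thesis using O' by (auto dest: open_contains_ball[THEN iffD1])
    next
      case False
      show ?thesis
      proof (cases "t \<in> {a..b}")
        case True
        then obtain D where "D \<le> 0" "(G has_real_derivative D) (at t)" using der False by blast
        then obtain r where "r > 0" "\<And>u v. u \<le> t \<Longrightarrow> t \<le> v \<Longrightarrow> \<bar>u - t\<bar> < r \<Longrightarrow> \<bar>v - t\<bar> < r \<Longrightarrow> G v - G u \<le> \<epsilon> * (v - u)"
          using has_real_derivative_increment_le \<epsilon> by metis
        then show ?thesis using False by auto
      qed (use False in \<open>auto intro: exI[of _ 1]\<close>)
    qed
    then obtain r where r: "\<And>t. r t > 0" and
      R: "\<And>t. if t \<in> N then ball t (r t) \<subseteq> O' else t \<in> {a..b} \<longrightarrow> (\<forall>u v. u \<le> t \<longrightarrow> t \<le> v \<longrightarrow> \<bar>u - t\<bar> < r t \<longrightarrow> \<bar>v - t\<bar> < r t \<longrightarrow> G v - G u \<le> \<epsilon> * (v - u))"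
      by metis
    have "gauge (\<lambda>t. ball t (r t))" using r by (auto simp: gauge_def)
    then obtain p where p: "p tagged_division_of {a..b}" "(\<lambda>t. ball t (r t)) fine p"
      using fine_division_exists_real by blast
    note pD = tagged_division_ofD[OF p(1)]
    have cell: "K = {Inf K..Sup K} \<and> Inf K \<le> t \<and> t \<le> Sup K \<and> Inf K \<in> {a..b} \<and> Sup K \<in> {a..b} \<and> K \<subseteq> ball t (r t)"
      if tk: "(t, K) \<in> p" for t K
    proof -
      obtain c e where K: "K = {c..e}" using pD(4)[OF tk] by auto
      have t: "t \<in> K" "K \<subseteq> {a..b}" using pD tk by auto
      have "K \<subseteq> ball t (r t)" using p(2) tk by (auto simp: fine_def)
      then show ?thesis using K t by auto
    qed
    \<comment> \<open>Degenerate cells are left out: a single point has empty interior and may sit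
      inside another cell, which would break the ordering of intervals demanded by \<open>D\<close>.
      Their increment is zero anyway.\<close>
    define p1 where "p1 = {(t, K) \<in> p. t \<in> N \<and> Inf K < Sup K}"
    have p1: "finite p1" "p1 \<subseteq> p" unfolding p1_def using pD(1) by (auto intro: finite_subset)
    have int: "interior K = {Inf K<..<Sup K}" if "(t, K) \<in> p" for t K
      using cell[OF that] by (metis interior_atLeastAtMost_real)
    have "(\<Sum>k\<in>p1. \<bar>G (Sup (snd k)) - G (Inf (snd k))\<bar>) < \<epsilon>"
    proof (rule D[rule_format, OF p1(1)])
      show "Inf (snd k) \<in> {a..b} \<and> Sup (snd k) \<in> {a..b} \<and> Inf (snd k) \<le> Sup (snd k)" if "k \<in> p1" for k
        using that p1 cell[of "fst k" "snd k"] by fastforce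
      have disj: "interior (snd k) \<inter> interior (snd k') = {}"
        if "k \<in> p1" "k' \<in> p1" "k \<noteq> k'" for k k'
        using that p1 pD(5)[of "fst k" "snd k" "fst k'" "snd k'"] by (metis prod.collapse subsetD)
      show "Sup (snd k) \<le> Inf (snd k') \<or> Sup (snd k') \<le> Inf (snd k)"
        if k: "k \<in> p1" "k' \<in> p1" "k \<noteq> k'" for k k'
      proof (rule ccontr)
        assume "\<not> ?thesis"
        moreover have "Inf (snd k) < Sup (snd k)" "Inf (snd k') < Sup (snd k')"
          using k unfolding p1_def by auto
        ultimately have "max (Inf (snd k)) (Inf (snd k')) < min (Sup (snd k)) (Sup (snd k'))"
          by auto
        then obtain s where "max (Inf (snd k)) (Inf (snd k')) < s" "s < min (Sup (snd k)) (Sup (snd k'))"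
          using dense by blast
        then have "s \<in> {Inf (snd k)<..<Sup (snd k)} \<inter> {Inf (snd k')<..<Sup (snd k')}" by auto
        then show False using disj[OF k] int[of "fst k" "snd k"] int[of "fst k'" "snd k'"] subsetD[OF p1(2) k(1)] subsetD[OF p1(2) k(2)] by auto
      qed
      have sub: "interior (snd k) \<subseteq> O'" if "k \<in> p1" for k
      proof -
        have "fst k \<in> N" "k \<in> p" using that unfolding p1_def by auto
        then have "snd k \<subseteq> ball (fst k) (r (fst k))" using cell[of "fst k" "snd k"] by auto
        then show ?thesis using R[of "fst k"] \<open>fst k \<in> N\<close> interior_subset[of "snd k"] by auto
      qed
      \<comment> \<open>Disjoint interiors inside \<open>O'\<close> turn the total length of the bad
        cells into a measure that is at most that of \<open>O'\<close>.\<close>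
      have "ennreal (\<Sum>k\<in>p1. Sup (snd k) - Inf (snd k)) = (\<Sum>k\<in>p1. ennreal (Sup (snd k) - Inf (snd k)))"
        by (rule sum_ennreal[symmetric]) (auto simp: p1_def)
      also have "\<dots> = (\<Sum>k\<in>p1. emeasure lborel (interior (snd k)))"
      proof (rule sum.cong)
        fix k assume "k \<in> p1"
        then have "interior (snd k) = {Inf (snd k)<..<Sup (snd k)}" "Inf (snd k) < Sup (snd k)"
          using p1 int[of "fst k" "snd k"] unfolding p1_def by auto
        then show "ennreal (Sup (snd k) - Inf (snd k)) = emeasure lborel (interior (snd k))"
          by simp
      qed simp
      also have "\<dots> = emeasure lborel (\<Union>k\<in>p1. interior (snd k))"
        using disj p1 by (intro sum_emeasure) (auto simp: disjoint_family_on_def)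
      also have "\<dots> \<le> emeasure lborel O'"
        using sub O' by (intro emeasure_mono) auto
      also have "\<dots> < ennreal \<delta>" by (fact emO)
      finally have "ennreal (\<Sum>k\<in>p1. Sup (snd k) - Inf (snd k)) < ennreal \<delta>" .
      moreover have "0 \<le> (\<Sum>k\<in>p1. Sup (snd k) - Inf (snd k))"
        by (intro sum_nonneg) (auto simp: p1_def)
      ultimately show "(\<Sum>k\<in>p1. Sup (snd k) - Inf (snd k)) < \<delta>"
        by (simp add: ennreal_less_iff)
    qed
    then have bad: "(\<Sum>k\<in>p1. G (Sup (snd k)) - G (Inf (snd k))) \<le> \<epsilon>"
      using sum_mono[of p1 "\<lambda>k. G (Sup (snd k)) - G (Inf (snd k))" "\<lambda>k. \<bar>G (Sup (snd k)) - G (Inf (snd k))\<bar>"] by force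
    have good: "(\<Sum>k\<in>p - p1. G (Sup (snd k)) - G (Inf (snd k))) \<le> (\<Sum>k\<in>p - p1. \<epsilon> * (Sup (snd k) - Inf (snd k)))"
    proof (rule sum_mono)
      fix k assume k: "k \<in> p - p1"
      obtain t K where tk: "k = (t, K)" by (cases k)
      note c = cell[of t K]
      show "G (Sup (snd k)) - G (Inf (snd k)) \<le> \<epsilon> * (Sup (snd k) - Inf (snd k))"
      proof (cases "t \<in> N")
        case True
        then have "Inf K = Sup K" using k tk c unfolding p1_def by force
        then show ?thesis using tk by simp
      next
        case False
        have "Inf K \<in> K" "Sup K \<in> K" using c k tk by (metis DiffD1 atLeastAtMost_iff order.trans order_refl)+
        then have "\<bar>Inf K - t\<bar> < r t" "\<bar>Sup K - t\<bar> < r t"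
          using c k tk by (auto simp: subset_iff dist_real_def abs_minus_commute)
        then show ?thesis using R[of t] False k tk c by auto
      qed
    qed
    have "G b - G a = (\<Sum>k\<in>p. G (Sup (snd k)) - G (Inf (snd k)))"
      using additive_tagged_division_1[OF ab p(1), of G] by (simp add: case_prod_unfold)
    also have "\<dots> = (\<Sum>k\<in>p - p1. G (Sup (snd k)) - G (Inf (snd k))) + (\<Sum>k\<in>p1. G (Sup (snd k)) - G (Inf (snd k)))"
      using p1 pD(1) by (intro sum.subset_diff) auto
    also have "\<dots> \<le> (\<Sum>k\<in>p - p1. \<epsilon> * (Sup (snd k) - Inf (snd k))) + \<epsilon>"
      using bad good by linarith
    also have "(\<Sum>k\<in>p - p1. \<epsilon> * (Sup (snd k) - Inf (snd k))) \<le> (\<Sum>k\<in>p. \<epsilon> * (Sup (snd k) - Inf (snd k)))"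
      using pD(1) \<epsilon> cell by (intro sum_mono2) fastforce+
    also have "\<dots> = \<epsilon> * (b - a)"
      using additive_tagged_division_1[OF ab p(1), of "\<lambda>t. t"]
      by (simp add: case_prod_unfold sum_distrib_left[symmetric])
    finally show ?thesis by (simp add: algebra_simps)
  qed
  then have *: "G b - G a \<le> \<epsilon> * (1 + (b - a))" if "\<epsilon> > 0" for \<epsilon> using that by blast
  show ?thesis
  proof (rule ccontr)
    assume "\<not> G b \<le> G a"
    define e where "e = 1 + (b - a)"
    have "e > 0" using ab by (simp add: e_def)
    \<comment> \<open>This choice of \<open>\<epsilon>\<close> bounds a supposedly positive
      increment by half of itself.\<close>
    then have "G b - G a \<le> (G b - G a) / (2 * e) * e"
      using *[of "(G b - G a) / (2 * e)"] \<open>\<not> G b \<le> G a\<close> by (simp add: e_def)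
    also have "\<dots> = (G b - G a) / 2" using \<open>e > 0\<close> by simp
    finally have "G b - G a \<le> (G b - G a) / 2" .
    then show False using \<open>\<not> G b \<le> G a\<close> by simp
  qed
qed

text \<open>Subtracting the line of slope \<open>c\<close> reduces this to the monotone case. It
  replaces the fundamental theorem of calculus: negative \<open>c\<close> gives energy drops,
  positive \<open>c\<close> gives Lipschitz bounds.\<close>

lemma abs_cont_on_decrease:
  fixes G :: "real \<Rightarrow> real"
  assumes ab: "a \<le> b" and ac: "abs_cont_on {a..b} G"
    and ae: "AE t in lborel. a < t \<and> t < b \<longrightarrow> (\<exists>D\<le>c. (G has_real_derivative D) (at t))"
  shows "G b \<le> G a + c * (b - a)"
proof -
  have "G b + - c * b \<le> G a + - c * a"
  proof (rule abs_cont_on_nonincreasing[OF ab, where G = "\<lambda>t. G t + - c * t"])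
    show "abs_cont_on {a..b} (\<lambda>t. G t + - c * t)"
      by (intro abs_cont_on_add abs_cont_on_mult abs_cont_on_const abs_cont_on_id ac)
    show "AE t in lborel. a < t \<and> t < b \<longrightarrow> (\<exists>D\<le>0. ((\<lambda>t. G t + - c * t) has_real_derivative D) (at t))"
      using ae
    proof eventually_elim
      case (elim t)
      show ?case
      proof
        assume "a < t \<and> t < b"
        then obtain D where "D \<le> c" "(G has_real_derivative D) (at t)" using elim by blast
        then show "\<exists>D\<le>0. ((\<lambda>t. G t + - c * t) has_real_derivative D) (at t)"
          by (intro exI[of _ "D + - c"]) (auto intro!: derivative_eq_intros)
      qed
    qed
  qed
  then show ?thesis by (simp add: algebra_simps)
qed

lemma abs_cont_on_exp: "abs_cont_on {0..T} (exp :: real \<Rightarrow> real)"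
proof (rule abs_cont_on_lipschitz)
  have *: "\<bar>exp v - exp u\<bar> \<le> exp T * \<bar>v - u\<bar>" if "u \<le> v" "v \<le> T" for u v :: real
  proof -
    have "exp v - exp u = exp v * (1 - exp (u - v))" by (simp add: algebra_simps exp_add[symmetric])
    also have "1 - exp (u - v) \<le> v - u"
      using exp_ge_add_one_self[of "u - v"] by linarith
    then have "exp v * (1 - exp (u - v)) \<le> exp T * (v - u)"
      using that by (intro mult_mono) auto
    finally show ?thesis using that by simp
  qed
  fix u v assume "u \<in> {0..T}" "v \<in> {0..T}"
  then show "\<bar>exp v - exp u\<bar> \<le> exp T * \<bar>v - u\<bar>"
    using *[of u v] *[of v u] by (cases "u \<le> v") (auto simp: abs_minus_commute)
qed

section \<open>Scalar linear relaxation with bounded forcing\<close>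

lemma relaxation_upper_bound:
  fixes u :: "real \<Rightarrow> real"
  assumes ac: "abs_cont_nonneg u" and C: "C \<ge> 0"
    and ae: "AE t in lborel. t > 0 \<longrightarrow> (\<exists>e\<le>C. (u has_real_derivative - u t + e) (at t))"
    and t: "t \<ge> 0"
  shows "u t \<le> \<bar>u 0\<bar> + C"
proof -
  \<comment> \<open>Integrating factor: the derivative of \<open>exp s * (u s - C)\<close> is
    \<open>exp s * (e - C)\<close>, which is nonpositive.\<close>
  have "exp t * (u t + - C) \<le> exp 0 * (u 0 + - C)"
  proof (rule abs_cont_on_nonincreasing[OF t, where G = "\<lambda>s. exp s * (u s + - C)"])
    have "abs_cont_on {0..t} u" using ac t by (simp add: abs_cont_nonneg_def)
    then show "abs_cont_on {0..t} (\<lambda>s. exp s * (u s + - C))"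
      by (intro abs_cont_on_mult abs_cont_on_exp abs_cont_on_add abs_cont_on_const)
    show "AE s in lborel. 0 < s \<and> s < t \<longrightarrow>
        (\<exists>D\<le>0. ((\<lambda>s. exp s * (u s + - C)) has_real_derivative D) (at s))"
      using ae
    proof eventually_elim
      case (elim s)
      show ?case
      proof
        assume "0 < s \<and> s < t"
        then obtain e where e: "e \<le> C" "(u has_real_derivative - u s + e) (at s)" using elim by blast
        have "((\<lambda>s. exp s * (u s + - C)) has_real_derivative exp s * (e - C)) (at s)"
          using e(2) by (auto intro!: derivative_eq_intros simp: algebra_simps)
        moreover have "exp s * (e - C) \<le> 0" using e(1) by (simp add: mult_nonneg_nonpos)
        ultimately show "\<exists>D\<le>0. ((\<lambda>s. exp s * (u s + - C)) has_real_derivative D) (at s)" by blast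
      qed
    qed
  qed
  then have le: "exp t * (u t - C) \<le> u 0 - C" by simp
  show ?thesis
  proof (cases "u t \<le> C")
    case False
    \<comment> \<open>The excess over \<open>C\<close> is positive here, so multiplying it by
      \<open>exp t \<ge> 1\<close> can only enlarge it.\<close>
    then have "u t - C \<le> exp t * (u t - C)" using t by (simp add: mult_le_cancel_right1)
    then show ?thesis using le C by linarith
  qed auto
qed

lemma relaxation_bounded:
  fixes u :: "real \<Rightarrow> real"
  assumes ac: "abs_cont_nonneg u"
    and ae: "AE t in lborel. t > 0 \<longrightarrow> (\<exists>e. \<bar>e\<bar> \<le> C \<and> (u has_real_derivative - u t + e) (at t))"
  shows "\<exists>B. (\<forall>t\<ge>0. \<bar>u t\<bar> \<le> B) \<and> (\<forall>s\<ge>0. \<forall>t\<ge>0. \<bar>u t - u s\<bar> \<le> B * \<bar>t - s\<bar>)"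
proof -
  \<comment> \<open>The sign of \<open>C\<close> is not known in advance, whereas the one-sided
    bound wants a nonnegative constant.\<close>
  define C' where "C' = \<bar>C\<bar>"
  have ae': "AE t in lborel. t > 0 \<longrightarrow> (\<exists>e. \<bar>e\<bar> \<le> C' \<and> (u has_real_derivative - u t + e) (at t))"
    using ae unfolding C'_def by eventually_elim (meson abs_ge_self order_trans)
  have acm: "abs_cont_on S v \<Longrightarrow> abs_cont_on S (\<lambda>t. - v t)" for S v
    by (rule abs_cont_on_dominated[where K = "{()}" and F = "\<lambda>_. v" and C = 1]) auto
  have C': "C' \<ge> 0" by (simp add: C'_def)
  have up: "u t \<le> \<bar>u 0\<bar> + C'" if "t \<ge> 0" for t
  proof (rule relaxation_upper_bound[OF ac C' _ that])
    show "AE t in lborel. t > 0 \<longrightarrow> (\<exists>e\<le>C'. (u has_real_derivative - u t + e) (at t))"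
      using ae' by eventually_elim (meson abs_le_D1)
  qed
  have lo: "- u t \<le> \<bar>- u 0\<bar> + C'" if "t \<ge> 0" for t
  proof (rule relaxation_upper_bound[OF _ C' _ that])
    show "abs_cont_nonneg (\<lambda>t. - u t)" using ac acm by (auto simp: abs_cont_nonneg_def)
    show "AE t in lborel. t > 0 \<longrightarrow> (\<exists>e\<le>C'. ((\<lambda>t. - u t) has_real_derivative - (- u t) + e) (at t))"
      using ae'
    proof eventually_elim
      case (elim t)
      show ?case
      proof
        assume "t > 0"
        then obtain e where "\<bar>e\<bar> \<le> C'" "(u has_real_derivative - u t + e) (at t)" using elim by blast
        then show "\<exists>e\<le>C'. ((\<lambda>t. - u t) has_real_derivative - (- u t) + e) (at t)"
          by (intro exI[of _ "- e"]) (auto intro!: derivative_eq_intros)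
      qed
    qed
  qed
  \<comment> \<open>One \<open>C'\<close> comes from the bound on \<open>u\<close>, the other from
    the forcing, so \<open>B\<close> bounds the derivative as well as \<open>u\<close>.\<close>
  define B where "B = \<bar>u 0\<bar> + 2 * C'"
  have bd: "\<bar>u t\<bar> \<le> \<bar>u 0\<bar> + C'" if "t \<ge> 0" for t using up[OF that] lo[OF that] by simp
  have lip: "\<bar>u t - u s\<bar> \<le> B * (t - s)" if st: "0 \<le> s" "s \<le> t" for s t
  proof -
    have acst: "abs_cont_on {s..t} u"
      using ac st abs_cont_on_subset[of "{0..t}" u "{s..t}"] by (auto simp: abs_cont_nonneg_def)
    have "u t \<le> u s + B * (t - s)"
    proof (rule abs_cont_on_decrease[OF st(2) acst])
      show "AE r in lborel. s < r \<and> r < t \<longrightarrow> (\<exists>D\<le>B. (u has_real_derivative D) (at r))"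
        using ae'
      proof eventually_elim
        case (elim r)
        show ?case
        proof
          assume r: "s < r \<and> r < t"
          then obtain e where "\<bar>e\<bar> \<le> C'" "(u has_real_derivative - u r + e) (at r)" using elim st by auto
          moreover then have "- u r + e \<le> B" using bd[of r] r st unfolding B_def by linarith
          ultimately show "\<exists>D\<le>B. (u has_real_derivative D) (at r)" by blast
        qed
      qed
    qed
    moreover have "- u t \<le> - u s + B * (t - s)"
    proof (rule abs_cont_on_decrease[OF st(2) acm[OF acst]])
      show "AE r in lborel. s < r \<and> r < t \<longrightarrow> (\<exists>D\<le>B. ((\<lambda>t. - u t) has_real_derivative D) (at r))"
        using ae'
      proof eventually_elim
        case (elim r)
        show ?case
        proof
          assume r: "s < r \<and> r < t"
          then obtain e where "\<bar>e\<bar> \<le> C'" "(u has_real_derivative - u r + e) (at r)" using elim st by auto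
          moreover then have "- (- u r + e) \<le> B" using bd[of r] r st unfolding B_def by linarith
          ultimately show "\<exists>D\<le>B. ((\<lambda>t. - u t) has_real_derivative D) (at r)"
            using DERIV_minus by blast
        qed
      qed
    qed
    ultimately show ?thesis by simp
  qed
  have "\<bar>u t - u s\<bar> \<le> B * \<bar>t - s\<bar>" if "0 \<le> s" "0 \<le> t" for s t
    using lip[of s t] lip[of t s] that by (cases "s \<le> t") (auto simp: abs_minus_commute)
  moreover have "\<bar>u t\<bar> \<le> B" if "0 \<le> t" for t
    using bd[OF that] C' unfolding B_def by linarith
  ultimately show ?thesis by blast
qed

subsection \<open>Lagrange multipliers\<close>

text \<open>The affine constraints \<open>\<phi> r = 0\<close> are removed one at a time: removing one is a
  separation problem on the line, solved by a supremum of slopes. The hypothesis \<open>refl\<close> is what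
  remains of Slater's condition.\<close>

lemma lagrange_multipliers_exist:
  fixes F :: "'a \<Rightarrow> real" and \<phi> :: "nat \<Rightarrow> 'a \<Rightarrow> real"
  assumes conv: "\<And>u v s. u \<in> X \<Longrightarrow> v \<in> X \<Longrightarrow> 0 < s \<Longrightarrow> s < 1 \<Longrightarrow>
      \<exists>w\<in>X. F w \<le> s * F u + (1 - s) * F v \<and> (\<forall>r<m. \<phi> r w = s * \<phi> r u + (1 - s) * \<phi> r v)"
    and refl: "\<And>u. u \<in> X \<Longrightarrow> \<exists>v\<in>X. \<exists>c>0. \<forall>r<m. \<phi> r v = - c * \<phi> r u"
    and opt: "\<And>u. u \<in> X \<Longrightarrow> (\<forall>r<m. \<phi> r u = 0) \<Longrightarrow> F0 \<le> F u"
  shows "\<exists>\<mu>. \<forall>u\<in>X. F0 \<le> F u - (\<Sum>r<m. \<mu> r * \<phi> r u)"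
proof -
  have "\<exists>\<mu>. \<forall>u\<in>X. (\<forall>r. k \<le> r \<longrightarrow> r < m \<longrightarrow> \<phi> r u = 0) \<longrightarrow> F0 \<le> F u - (\<Sum>r<k. \<mu> r * \<phi> r u)"
    if "k \<le> m" for k
    using that
  proof (induction k)
    case 0
    then show ?case using opt by auto
  next
    case (Suc k)
    then obtain \<mu> where \<mu>: "\<And>u. u \<in> X \<Longrightarrow> (\<forall>r. k \<le> r \<longrightarrow> r < m \<longrightarrow> \<phi> r u = 0) \<Longrightarrow>
        F0 \<le> F u - (\<Sum>r<k. \<mu> r * \<phi> r u)"
      by auto
    have km: "k < m" using Suc by auto
    define G where "G u = F u - (\<Sum>r<k. \<mu> r * \<phi> r u) - F0" for u
    define Y where "Y = {u \<in> X. \<forall>r. Suc k \<le> r \<longrightarrow> r < m \<longrightarrow> \<phi> r u = 0}"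
    have G0: "0 \<le> G u" if "u \<in> Y" "\<phi> k u = 0" for u
    proof -
      have "\<forall>r. k \<le> r \<longrightarrow> r < m \<longrightarrow> \<phi> r u = 0"
        using that unfolding Y_def by (metis (mono_tags, lifting) Suc_leI le_neq_implies_less mem_Collect_eq)
      then show ?thesis using \<mu>[of u] that unfolding G_def Y_def by auto
    qed
    have slopes: "G v / \<phi> k v \<le> G u / \<phi> k u"
      if u: "u \<in> Y" "\<phi> k u > 0" and v: "v \<in> Y" "\<phi> k v < 0" for u v
    proof -
      \<comment> \<open>The weight at which the convex combination of \<open>u\<close> and
        \<open>v\<close> satisfies the constraint \<open>\<phi> k = 0\<close>, so that
        \<open>G0\<close> applies to it.\<close>
      define s where "s = - \<phi> k v / (\<phi> k u - \<phi> k v)"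
      have s: "0 < s" "s < 1" unfolding s_def using u v by (auto simp: field_simps)
      have s1: "1 - s = \<phi> k u / (\<phi> k u - \<phi> k v)" unfolding s_def using u v by (auto simp: field_simps)
      obtain w where w: "w \<in> X" "F w \<le> s * F u + (1 - s) * F v"
        "\<And>r. r < m \<Longrightarrow> \<phi> r w = s * \<phi> r u + (1 - s) * \<phi> r v"
        using conv[OF _ _ s, of u v] u v unfolding Y_def by blast
      have "w \<in> Y" using w u v unfolding Y_def by auto
      moreover have "\<phi> k w = 0"
        unfolding w(3)[OF km] s1 unfolding s_def by (simp add: mult.commute)
      ultimately have "0 \<le> G w" by (rule G0)
      also have "G w \<le> s * G u + (1 - s) * G v"
      proof -
        have "(\<Sum>r<k. \<mu> r * \<phi> r w) = (\<Sum>r<k. s * (\<mu> r * \<phi> r u) + (1 - s) * (\<mu> r * \<phi> r v))"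
          using w(3) km by (intro sum.cong) (simp_all add: distrib_left mult.left_commute)
        also have "\<dots> = s * (\<Sum>r<k. \<mu> r * \<phi> r u) + (1 - s) * (\<Sum>r<k. \<mu> r * \<phi> r v)"
          by (simp add: sum.distrib sum_distrib_left)
        finally show ?thesis using w(2) unfolding G_def by (simp add: algebra_simps)
      qed
      finally have "0 \<le> (- \<phi> k v * G u + \<phi> k u * G v) / (\<phi> k u - \<phi> k v)"
        unfolding s1 unfolding s_def by (simp add: add_divide_distrib diff_divide_distrib)
      then have "0 \<le> - \<phi> k v * G u + \<phi> k u * G v"
        using u v by (simp add: zero_le_divide_iff)
      then show ?thesis using u v by (simp add: field_simps)
    qed
    have "\<exists>c. \<forall>u\<in>Y. 0 \<le> G u - c * \<phi> k u"
    proof (cases "\<exists>v\<in>Y. \<phi> k v < 0")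
      case False
      \<comment> \<open>Reflection flips the sign of \<open>\<phi> k\<close>, so the absence of
        negative values rules out positive ones. The constraint then holds throughout
        \<open>Y\<close> and the choice of multiplier is free.\<close>
      have "\<phi> k u = 0" if uY: "u \<in> Y" for u
      proof -
        obtain v c where v: "v \<in> X" "c > 0" "\<And>r. r < m \<Longrightarrow> \<phi> r v = - c * \<phi> r u"
          using refl[of u] uY unfolding Y_def by blast
        then have "v \<in> Y" using uY unfolding Y_def by auto
        then have "\<phi> k v \<ge> 0" "\<phi> k u \<ge> 0" using False uY by force+
        then show ?thesis using v(2) v(3)[OF km] by (auto simp: zero_le_mult_iff mult_le_0_iff)
      qed
      then show ?thesis using G0 by auto
    next
      case True
      then obtain v0 where v0: "v0 \<in> Y" "\<phi> k v0 < 0" by blast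
      obtain u0 where u0: "u0 \<in> Y" "\<phi> k u0 > 0"
      proof -
        obtain v c where v: "v \<in> X" "c > 0" "\<And>r. r < m \<Longrightarrow> \<phi> r v = - c * \<phi> r v0"
          using refl[of v0] v0 unfolding Y_def by blast
        then have "v \<in> Y" using v0 unfolding Y_def by auto
        moreover have "\<phi> k v > 0" using v(2) v(3)[OF km] v0 by (auto simp: zero_less_mult_iff mult_less_0_iff)
        ultimately show ?thesis using that by blast
      qed
      \<comment> \<open>By \<open>slopes\<close>, every slope on the negative side lies below every
        slope on the positive side; any number between the two families is a multiplier, and the
        supremum of the lower family is one.\<close>
      define A where "A = (\<lambda>v. G v / \<phi> k v) ` {v \<in> Y. \<phi> k v < 0}"
      have ne: "A \<noteq> {}" using v0 unfolding A_def by auto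
      have bdd: "bdd_above A" unfolding A_def using slopes[OF u0] by (intro bdd_aboveI[of _ "G u0 / \<phi> k u0"]) auto
      have "0 \<le> G u - Sup A * \<phi> k u" if u: "u \<in> Y" for u
      proof -
        consider "\<phi> k u = 0" | "\<phi> k u > 0" | "\<phi> k u < 0" by linarith
        then show ?thesis
        proof cases
          case 1
          then show ?thesis using G0 u by auto
        next
          case 2
          have "Sup A \<le> G u / \<phi> k u"
            using ne slopes[OF u 2] by (intro cSup_least) (auto simp: A_def)
          then show ?thesis using 2 by (simp add: field_simps)
        next
          case 3
          have "G u / \<phi> k u \<le> Sup A"
            using bdd 3 u by (intro cSup_upper) (auto simp: A_def)
          then show ?thesis using 3 by (simp add: field_simps)
        qed
      qed
      then show ?thesis by blast
    qed
    then obtain c where c: "\<And>u. u \<in> Y \<Longrightarrow> 0 \<le> G u - c * \<phi> k u" by blast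
    show ?case
    proof (intro exI[of _ "\<mu>(k := c)"] ballI impI)
      fix u assume u: "u \<in> X" "\<forall>r. Suc k \<le> r \<longrightarrow> r < m \<longrightarrow> \<phi> r u = 0"
      have "(\<Sum>r<k. (\<mu>(k := c)) r * \<phi> r u) = (\<Sum>r<k. \<mu> r * \<phi> r u)"
        by (intro sum.cong) auto
      then show "F0 \<le> F u - (\<Sum>r<Suc k. (\<mu>(k := c)) r * \<phi> r u)"
        using c[of u] u unfolding Y_def G_def by simp
    qed
  qed
  from this[of m] show ?thesis by auto
qed

subsection \<open>The graph Laplacian\<close>

text \<open>Acts on scalars, one per agent. The operator \<open>L\<close> of the algorithm applies
  it to each of the \<open>m\<close> coordinates separately.\<close>

definition laplacian :: "nat \<Rightarrow> (nat \<Rightarrow> nat \<Rightarrow> real) \<Rightarrow> (nat \<Rightarrow> real) \<Rightarrow> nat \<Rightarrow> real" where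
  "laplacian n a v i = (\<Sum>j<n. a i j * (v i - v j))"

lemma laplacian_linear:
  "laplacian n a (\<lambda>i. s * u i + t * v i) i = s * laplacian n a u i + t * laplacian n a v i"
  unfolding laplacian_def sum_distrib_left sum.distrib[symmetric]
  by (intro sum.cong) (auto simp: algebra_simps)

text \<open>Exchanging the summation indices and averaging gives the Dirichlet form; each edge is
  counted in both directions, hence the factor 1/2.\<close>

lemma laplacian_form:
  assumes "\<And>i j. a i j = a j i"
  shows "(\<Sum>i<n. u i * laplacian n a v i) = (\<Sum>i<n. \<Sum>j<n. a i j * (u i - u j) * (v i - v j)) / 2"
proof -
  have 1: "(\<Sum>i<n. u i * laplacian n a v i) = (\<Sum>i<n. \<Sum>j<n. a i j * u i * (v i - v j))"
    unfolding laplacian_def sum_distrib_left by (simp add: mult.assoc mult.left_commute)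
  have 2: "(\<Sum>i<n. \<Sum>j<n. a i j * u i * (v i - v j)) = (\<Sum>i<n. \<Sum>j<n. a i j * u j * (v j - v i))"
    by (subst sum.swap) (simp add: assms)
  have "(\<Sum>i<n. \<Sum>j<n. a i j * (u i - u j) * (v i - v j)) =
     (\<Sum>i<n. \<Sum>j<n. a i j * u i * (v i - v j) + a i j * u j * (v j - v i))"
    by (intro sum.cong) (auto simp: algebra_simps)
  also have "\<dots> = 2 * (\<Sum>i<n. \<Sum>j<n. a i j * u i * (v i - v j))"
    by (simp add: sum.distrib 2)
  finally show ?thesis using 1 by simp
qed

lemma laplacian_self_adjoint:
  assumes "\<And>i j. a i j = a j i"
  shows "(\<Sum>i<n. u i * laplacian n a v i) = (\<Sum>i<n. v i * laplacian n a u i)"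
  unfolding laplacian_form[of a, OF assms] by (simp add: mult_ac)

lemma laplacian_form_nonneg:
  assumes "\<And>i j. a i j = a j i" "\<And>i j. a i j \<ge> 0"
  shows "(\<Sum>i<n. u i * laplacian n a u i) \<ge> 0"
  unfolding laplacian_form[of a, OF assms(1)]
  by (auto intro!: sum_nonneg simp: assms(2) mult.assoc)

text \<open>A vanishing Dirichlet form forces equality across every edge of positive weight, and
  equality then propagates along paths.\<close>

lemma laplacian_kernel:
  assumes sym: "\<And>i j. a i j = a j i" and nn: "\<And>i j. a i j \<ge> 0" and conn: "graph_connected n a"
    and 0: "\<And>i. i < n \<Longrightarrow> laplacian n a u i = 0" and ij: "i < n" "j < n"
  shows "u i = u j"
proof -
  have "(\<Sum>i<n. \<Sum>j<n. a i j * (u i - u j) * (u i - u j)) = 0"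
    using laplacian_form[of a u n u, OF sym] 0 by simp
  moreover have nn': "0 \<le> a i j * (u i - u j) * (u i - u j)" for i j
    using nn[of i j] by (simp add: mult.assoc)
  ultimately have z: "a i j * (u i - u j) * (u i - u j) = 0" if "i < n" "j < n" for i j
    using that by (simp add: sum_nonneg_eq_0_iff sum_nonneg)
  have step: "u i = u j" if "i < n \<and> j < n \<and> a i j > 0" for i j
    using z[of i j] that by auto
  have "(\<lambda>u v. u < n \<and> v < n \<and> a u v > 0)\<^sup>*\<^sup>* i j"
    using conn ij unfolding graph_connected_def by blast
  then show ?thesis
    by (induction rule: rtranclp_induct) (auto simp: step)
qed

text \<open>The range of a symmetric operator is the orthogonal complement of its kernel, here the
  constants. To get this from multipliers, minimise the linear function
  \<open>\<Sum>i<n. b i * u i\<close> subject to \<open>laplacian n a u = 0\<close>: admissible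
  \<open>u\<close> are constant on the agents, so the minimum is 0, and the multiplier itself is the
  solution.\<close>

lemma laplacian_solvable:
  assumes sym: "\<And>i j. a i j = a j i" and nn: "\<And>i j. a i j \<ge> 0" and conn: "graph_connected n a"
    and b: "(\<Sum>i<n. b i) = 0"
  shows "\<exists>z. \<forall>i<n. laplacian n a z i = b i"
proof -
  have "\<exists>\<mu>. \<forall>u\<in>UNIV. 0 \<le> (\<Sum>i<n. b i * u i) - (\<Sum>r<n. \<mu> r * laplacian n a u r)"
  proof (rule lagrange_multipliers_exist)
    fix u v :: "nat \<Rightarrow> real" and s :: real
    show "\<exists>w\<in>UNIV. (\<Sum>i<n. b i * w i) \<le> s * (\<Sum>i<n. b i * u i) + (1 - s) * (\<Sum>i<n. b i * v i) \<and>
        (\<forall>r<n. laplacian n a w r = s * laplacian n a u r + (1 - s) * laplacian n a v r)"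
      by (intro bexI[of _ "\<lambda>i. s * u i + (1 - s) * v i"] conjI)
        (auto simp: laplacian_linear sum_distrib_left sum.distrib[symmetric] distrib_left mult.left_commute)
    show "\<exists>v\<in>UNIV. \<exists>c>0. \<forall>r<n. laplacian n a v r = - c * laplacian n a u r"
      using laplacian_linear[of n a "-1" u 0 u] by (intro bexI[of _ "\<lambda>i. - u i"] exI[of _ 1]) auto
    assume u: "\<forall>r<n. laplacian n a u r = 0"
    have "(\<Sum>i<n. b i * u i) = (\<Sum>i<n. b i * u 0)"
    proof (intro sum.cong refl)
      fix i assume "i \<in> {..<n}"
      then have "u i = u 0" using u by (intro laplacian_kernel[OF sym nn conn]) auto
      then show "b i * u i = b i * u 0" by simp
    qed
    also have "\<dots> = 0" using b by (simp add: sum_distrib_right[symmetric])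
    finally show "0 \<le> (\<Sum>i<n. b i * u i)" by simp
  qed
  then obtain \<mu> where "\<And>u. 0 \<le> (\<Sum>i<n. b i * u i) - (\<Sum>r<n. \<mu> r * laplacian n a u r)" by auto
  then have \<mu>: "0 \<le> (\<Sum>i<n. (b i - laplacian n a \<mu> i) * u i)" for u
    by (simp add: laplacian_self_adjoint[of a \<mu>, OF sym] left_diff_distrib sum_subtractf
        mult.commute[of "laplacian n a \<mu> _"])
  \<comment> \<open>A linear function that is nonnegative everywhere vanishes; it is tested at the
    negative of its own coefficient vector.\<close>
  have "(\<Sum>i<n. (b i - laplacian n a \<mu> i)\<^sup>2) \<le> 0"
    using \<mu>[of "\<lambda>i. - (b i - laplacian n a \<mu> i)"]
    by (simp only: mult_minus_right sum_negf power2_eq_square)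
  then have "(\<Sum>i<n. (b i - laplacian n a \<mu> i)\<^sup>2) = 0"
    by (simp add: antisym sum_nonneg)
  then have "\<forall>i<n. laplacian n a \<mu> i = b i"
    by (auto simp: sum_nonneg_eq_0_iff)
  then show ?thesis by blast
qed

subsection \<open>Topology of coordinate vectors\<close>

text \<open>In the product topology a neighbourhood restricts each coordinate separately. Members of
  \<open>vecs q\<close> agree from index \<open>q\<close> on, so only finitely many radii matter and
  they have a positive minimum.\<close>

lemma openin_vecs_contains_cube:
  assumes "openin (top_of_set (vecs q)) U" "x \<in> U"
  shows "\<exists>\<epsilon>>0. \<forall>v\<in>vecs q. (\<forall>j<q. \<bar>v j - x j\<bar> \<le> \<epsilon>) \<longrightarrow> v \<in> U"
proof -
  obtain T where T: "open T" "U = vecs q \<inter> T"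
    using assms(1) by (auto simp: openin_open)
  have "openin (product_topology (\<lambda>i::nat. euclidean :: real topology) UNIV) T"
    using T(1) by (simp add: open_fun_def)
  from product_topology_open_contains_basis[OF this, of x]
  obtain X where X: "x \<in> (\<Pi>\<^sub>E i\<in>UNIV. X i)" "\<And>i. open (X i)" "(\<Pi>\<^sub>E i\<in>UNIV. X i) \<subseteq> T"
    using assms(2) T(2) by auto
  have xX: "x i \<in> X i" for i using X(1) by auto
  have "\<forall>i. \<exists>e>0. \<forall>s. \<bar>s - x i\<bar> < e \<longrightarrow> s \<in> X i"
    using X(2) xX by (auto simp: open_real)
  then obtain e where e: "\<And>i. e i > 0" "\<And>i s. \<bar>s - x i\<bar> < e i \<Longrightarrow> s \<in> X i" by metis
  \<comment> \<open>Halving allows a closed cube, and the inserted 1 covers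
    \<open>q = 0\<close>.\<close>
  define \<epsilon> where "\<epsilon> = Min (insert 1 (e ` {..<q})) / 2"
  have m0: "0 < Min (insert 1 (e ` {..<q}))" using e by auto
  have "\<epsilon> > 0" using m0 unfolding \<epsilon>_def by simp
  have \<epsilon>e: "\<epsilon> < e j" if "j < q" for j
  proof -
    have "Min (insert 1 (e ` {..<q})) \<le> e j" using that by auto
    then show ?thesis using m0 unfolding \<epsilon>_def by linarith
  qed
  show ?thesis
  proof (intro exI[of _ \<epsilon>] conjI \<open>\<epsilon> > 0\<close> ballI impI)
    fix v assume v: "v \<in> vecs q" "\<forall>j<q. \<bar>v j - x j\<bar> \<le> \<epsilon>"
    have "v j \<in> X j" for j
    proof (cases "j < q")
      case True
      then show ?thesis using v(2) \<epsilon>e[OF True] by (intro e(2)) force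
    next
      case False
      then have "v j = x j" using v(1) assms(2) T(2) by (auto simp: vecs_def)
      then show ?thesis using xX by simp
    qed
    then show "v \<in> U" using X(3) T(2) v(1) by auto
  qed
qed

lemma open_coordinate_cube: "open {v :: nat \<Rightarrow> real. \<forall>j<q. \<bar>v j - x j\<bar> < \<epsilon>}"
proof -
  have "{v :: nat \<Rightarrow> real. \<forall>j<q. \<bar>v j - x j\<bar> < \<epsilon>} = (\<Inter>j<q. {v. \<bar>v j - x j\<bar> < \<epsilon>})" by auto
  also have "open \<dots>"
    by (intro open_INT finite_lessThan ballI open_Collect_less continuous_intros) auto
  finally show ?thesis .
qed

text \<open>By Tychonoff a product of compact intervals is compact; the coordinates from
  \<open>q\<close> on are pinned to the singleton zero.\<close>

lemma compact_vecs_cube: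
  assumes "closed S" "S \<subseteq> vecs q"
  shows "compact (S \<inter> {v. \<forall>j<q. \<bar>v j - x j\<bar> \<le> R})"
proof -
  define C where "C = (\<lambda>j. if j < q then {x j - R..x j + R} else {0 :: real})"
  have "compactin (product_topology (\<lambda>i::nat. euclidean :: real topology) UNIV) (PiE UNIV C)"
    by (auto simp: compactin_PiE C_def)
  then have "compact (PiE UNIV C)"
    by (simp add: euclidean_product_topology)
  then have "compact (PiE UNIV C \<inter> S)" using assms(1) by (rule compact_Int_closed)
  moreover have "PiE UNIV C \<inter> S = S \<inter> {v. \<forall>j<q. \<bar>v j - x j\<bar> \<le> R}"
  proof -
    have "v \<in> PiE UNIV C \<longleftrightarrow> (\<forall>j<q. \<bar>v j - x j\<bar> \<le> R)" if "v \<in> S" for v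
    proof -
      have "v j = 0" if "j \<ge> q" for j using assms(2) \<open>v \<in> S\<close> that by (auto simp: vecs_def)
      then have "v j \<in> C j \<longleftrightarrow> (j < q \<longrightarrow> \<bar>v j - x j\<bar> \<le> R)" for j
        by (cases "j < q") (auto simp: C_def abs_le_iff)
      then show ?thesis by (auto simp: PiE_iff)
    qed
    then show ?thesis by auto
  qed
  ultimately show ?thesis by simp
qed

text \<open>Finitely many local bounds have a maximum, and monotonicity in \<open>B\<close> lets it
  serve everywhere. Applied to subgradients, and with \<open>1 / B\<close> to a positive lower
  bound.\<close>

lemma compact_uniform_bound:
  fixes Q :: "real \<Rightarrow> 'a::topological_space \<Rightarrow> bool"
  assumes "compact K"
    and loc: "\<And>x. x \<in> K \<Longrightarrow> \<exists>T B. open T \<and> x \<in> T \<and> (\<forall>v\<in>T \<inter> K. Q B v)"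
    and mono: "\<And>B B' v. B \<le> B' \<Longrightarrow> Q B v \<Longrightarrow> Q B' v"
  shows "\<exists>B. \<forall>v\<in>K. Q B v"
proof -
  obtain T B where TB: "\<And>x. x \<in> K \<Longrightarrow> open (T x) \<and> x \<in> T x \<and> (\<forall>v\<in>T x \<inter> K. Q (B x) v)"
    using loc by metis
  obtain D where D: "D \<subseteq> K" "finite D" "K \<subseteq> (\<Union>x\<in>D. T x)"
    using compactE_image[OF assms(1), of K T] TB by blast
  show ?thesis
  proof (intro exI[of _ "Max (insert 0 (B ` D))"] ballI)
    fix v assume v: "v \<in> K"
    then obtain x where x: "x \<in> D" "v \<in> T x" using D by blast
    then have "Q (B x) v" using TB D v by blast
    moreover have "B x \<le> Max (insert 0 (B ` D))" using D x by auto
    ultimately show "Q (Max (insert 0 (B ` D))) v" using mono by blast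
  qed
qed

subsection \<open>Convex functions of coordinate vectors\<close>

lemma strict_convex_vec_on_imp_le:
  assumes f: "strict_convex_vec_on U f" and uv: "u \<in> U" "v \<in> U" and s: "0 \<le> s" "s \<le> 1"
  shows "f (\<lambda>j. s * u j + (1 - s) * v j) \<le> s * f u + (1 - s) * f v"
proof -
  consider "u = v" | "s = 0" | "s = 1" | "u \<noteq> v" "0 < s" "s < 1" using s by linarith
  then show ?thesis
  proof cases
    case 1
    have "(\<lambda>j. s * v j + (1 - s) * v j) = v" by (auto simp: algebra_simps)
    with 1 show ?thesis by (simp add: algebra_simps)
  next
    case 4
    then show ?thesis using f uv unfolding strict_convex_vec_on_def by (simp add: less_imp_le)
  qed auto
qed

text \<open>A convex function on a cube is bounded by its values at the vertices. The induction
  frees one coordinate at a time: \<open>k\<close> is the number of free coordinates and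
  \<open>c\<close> prescribes the others.\<close>

lemma strict_convex_bounded_above_on_cube:
  assumes f: "strict_convex_vec_on U f" and \<epsilon>: "\<epsilon> > 0" and x: "x \<in> vecs q"
    and cube: "\<And>v. v \<in> vecs q \<Longrightarrow> (\<forall>j<q. \<bar>v j - x j\<bar> \<le> \<epsilon>) \<Longrightarrow> v \<in> U"
  shows "\<exists>M. \<forall>v\<in>vecs q. (\<forall>j<q. \<bar>v j - x j\<bar> \<le> \<epsilon>) \<longrightarrow> f v \<le> M"
proof -
  define Q where "Q = {v \<in> vecs q. \<forall>j<q. \<bar>v j - x j\<bar> \<le> \<epsilon>}"
  have QU: "v \<in> U" if "v \<in> Q" for v using that cube unfolding Q_def by blast
  have "\<forall>c\<in>Q. \<exists>M. \<forall>v\<in>Q. (\<forall>j\<ge>k. v j = c j) \<longrightarrow> f v \<le> M" if "k \<le> q" for k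
    using that
  proof (induction k)
    case 0
    have "v = c" if "\<forall>j\<ge>0. v j = c j" for v c :: "nat \<Rightarrow> real" using that by auto
    then show ?case by blast
  next
    case (Suc k)
    have upd: "v(k := x k + \<sigma> * \<epsilon>) \<in> Q" if "v \<in> Q" "\<bar>\<sigma>\<bar> = 1" for v \<sigma>
      using that Suc(2) \<epsilon> unfolding Q_def by (auto simp: vecs_def abs_mult)
    show ?case
    proof
      fix c assume c: "c \<in> Q"
      obtain M1 where M1: "\<And>v. v \<in> Q \<Longrightarrow> (\<forall>j\<ge>k. v j = (c(k := x k + 1 * \<epsilon>)) j) \<Longrightarrow> f v \<le> M1"
        using Suc upd[OF c, of 1] by (metis Suc_leD abs_one)
      obtain M2 where M2: "\<And>v. v \<in> Q \<Longrightarrow> (\<forall>j\<ge>k. v j = (c(k := x k + (-1) * \<epsilon>)) j) \<Longrightarrow> f v \<le> M2"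
        using Suc upd[OF c, of "-1"] by (metis Suc_leD abs_minus_cancel abs_one)
      show "\<exists>M. \<forall>v\<in>Q. (\<forall>j\<ge>Suc k. v j = c j) \<longrightarrow> f v \<le> M"
      proof (intro exI[of _ "max M1 M2"] ballI impI)
        fix v assume v: "v \<in> Q" "\<forall>j\<ge>Suc k. v j = c j"
        \<comment> \<open>The relative position of \<open>v k\<close> between the two opposite
          faces, so that \<open>v\<close> is the corresponding combination of its translates
          \<open>v1\<close> and \<open>v2\<close> on them.\<close>
        define s where "s = (v k - (x k - \<epsilon>)) / (2 * \<epsilon>)"
        have vk: "\<bar>v k - x k\<bar> \<le> \<epsilon>" using v Suc(2) unfolding Q_def by auto
        have s: "0 \<le> s" "s \<le> 1" unfolding s_def using vk \<epsilon> by (auto simp: field_simps abs_le_iff)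
        define v1 where "v1 = v(k := x k + 1 * \<epsilon>)"
        define v2 where "v2 = v(k := x k + (-1) * \<epsilon>)"
        have v12: "v1 \<in> Q" "v2 \<in> Q" unfolding v1_def v2_def using upd[OF v(1), of 1] upd[OF v(1), of "-1"] by auto
        have "v = (\<lambda>j. s * v1 j + (1 - s) * v2 j)"
        proof
          fix j
          have "v k = s * (x k + \<epsilon>) + (1 - s) * (x k - \<epsilon>)"
            unfolding s_def using \<epsilon> by (simp add: field_simps)
          then show "v j = s * v1 j + (1 - s) * v2 j"
            unfolding v1_def v2_def by (auto simp: algebra_simps)
        qed
        then have "f v \<le> s * f v1 + (1 - s) * f v2"
          using strict_convex_vec_on_imp_le[OF f, of v1 v2 s] v12 QU s by auto
        also have "\<dots> \<le> s * max M1 M2 + (1 - s) * max M1 M2"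
        proof (intro add_mono mult_left_mono)
          have "f v1 \<le> M1" by (rule M1) (use v12 v(2) in \<open>auto simp: v1_def not_less_eq_eq[symmetric]\<close>)
          then show "f v1 \<le> max M1 M2" by simp
          have "f v2 \<le> M2" by (rule M2) (use v12 v(2) in \<open>auto simp: v2_def not_less_eq_eq[symmetric]\<close>)
          then show "f v2 \<le> max M1 M2" by simp
        qed (use s in auto)
        also have "\<dots> = max M1 M2" by (simp add: algebra_simps)
        finally show "f v \<le> max M1 M2" .
      qed
    qed
  qed
  from this[of q] have "\<forall>c\<in>Q. \<exists>M. \<forall>v\<in>Q. (\<forall>j\<ge>q. v j = c j) \<longrightarrow> f v \<le> M" by simp
  moreover have "x \<in> Q" using x \<epsilon> unfolding Q_def by auto
  ultimately obtain M where "\<And>v. v \<in> Q \<Longrightarrow> (\<forall>j\<ge>q. v j = x j) \<Longrightarrow> f v \<le> M" by blast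
  then show ?thesis using x unfolding Q_def vecs_def by auto
qed

text \<open>If \<open>v\<close> is close to \<open>x\<close>, continuing the segment from
  \<open>v\<close> through \<open>x\<close> reaches a point \<open>w\<close> still in the cube where
  \<open>f \<le> M\<close>. Convexity at \<open>x\<close> then prevents \<open>f v\<close> from
  being much smaller than \<open>f x\<close>.\<close>

lemma strict_convex_lower_semicontinuous:
  assumes U: "openin (top_of_set (vecs q)) U" and f: "strict_convex_vec_on U f"
    and x: "x \<in> U" and \<eta>: "\<eta> > 0"
  shows "\<exists>\<epsilon>>0. \<forall>v\<in>vecs q. (\<forall>j<q. \<bar>v j - x j\<bar> \<le> \<epsilon>) \<longrightarrow> f v \<ge> f x - \<eta>"
proof -
  have xq: "x \<in> vecs q" using U x by (auto simp: openin_open)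
  obtain \<epsilon> where \<epsilon>: "\<epsilon> > 0" and cube: "\<And>v. v \<in> vecs q \<Longrightarrow> (\<forall>j<q. \<bar>v j - x j\<bar> \<le> \<epsilon>) \<Longrightarrow> v \<in> U"
    using openin_vecs_contains_cube[OF U x] by blast
  obtain M where M: "\<And>v. v \<in> vecs q \<Longrightarrow> (\<forall>j<q. \<bar>v j - x j\<bar> \<le> \<epsilon>) \<Longrightarrow> f v \<le> M"
    using strict_convex_bounded_above_on_cube[OF f \<epsilon> xq cube] by blast
  have Mx: "f x \<le> M" using M[OF xq] \<epsilon> by simp
  \<comment> \<open>Small enough for \<open>\<theta> * (M - f x) \<le> \<eta>\<close>; the added 1
    keeps the denominator positive when \<open>M = f x\<close>.\<close>
  define \<theta> where "\<theta> = min 1 (\<eta> / (M - f x + 1))"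
  have \<theta>: "0 < \<theta>" "\<theta> \<le> 1" unfolding \<theta>_def using \<eta> Mx by auto
  have \<theta>M: "\<theta> * (M - f x) \<le> \<eta>"
  proof -
    have "\<theta> * (M - f x) \<le> \<theta> * (M - f x + 1)" using \<theta> by simp
    also have "\<dots> \<le> \<eta> / (M - f x + 1) * (M - f x + 1)"
      unfolding \<theta>_def using Mx by (intro mult_right_mono) auto
    also have "\<dots> = \<eta>" using Mx by simp
    finally show ?thesis .
  qed
  show ?thesis
  proof (intro exI[of _ "\<theta> * \<epsilon>"] conjI ballI impI)
    show "0 < \<theta> * \<epsilon>" using \<theta> \<epsilon> by simp
    fix v assume v: "v \<in> vecs q" "\<forall>j<q. \<bar>v j - x j\<bar> \<le> \<theta> * \<epsilon>"
    have "\<theta> * \<epsilon> \<le> \<epsilon>" using \<theta> \<epsilon> by (simp add: mult_left_le_one_le)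
    then have vU: "v \<in> U" using v by (intro cube) force+
    \<comment> \<open>Chosen so that \<open>x\<close> is the weighted mean
      \<open>(v + \<theta> w) / (1 + \<theta>)\<close>.\<close>
    define w where "w = (\<lambda>j. x j + (x j - v j) / \<theta>)"
    have wq: "w \<in> vecs q" using v(1) xq unfolding w_def vecs_def by auto
    have wc: "\<forall>j<q. \<bar>w j - x j\<bar> \<le> \<epsilon>"
      using v(2) \<theta> unfolding w_def by (auto simp: abs_minus_commute field_simps)
    define s where "s = 1 / (1 + \<theta>)"
    have s: "0 \<le> s" "s \<le> 1" "1 - s = \<theta> / (1 + \<theta>)" unfolding s_def using \<theta> by (auto simp: field_simps)
    have "x = (\<lambda>j. s * v j + (1 - s) * w j)"
    proof
      fix j
      have "s * v j + (1 - s) * w j = (v j + \<theta> * w j) / (1 + \<theta>)"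
        unfolding s(3) unfolding s_def by (simp add: add_divide_distrib)
      also have "v j + \<theta> * w j = (1 + \<theta>) * x j" unfolding w_def using \<theta> by (simp add: field_simps)
      finally show "x j = s * v j + (1 - s) * w j" using \<theta> by simp
    qed
    then have "f x \<le> s * f v + (1 - s) * f w"
      using strict_convex_vec_on_imp_le[OF f vU cube[OF wq wc] s(1,2)] by simp
    also have "\<dots> = (f v + \<theta> * f w) / (1 + \<theta>)"
      unfolding s(3) unfolding s_def by (simp add: add_divide_distrib)
    also have "\<dots> \<le> (f v + \<theta> * M) / (1 + \<theta>)"
      using M[OF wq wc] \<theta> by (intro divide_right_mono add_left_mono mult_left_mono) auto
    finally have "f x * (1 + \<theta>) \<le> f v + \<theta> * M" using \<theta> by (simp add: pos_le_divide_eq)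
    then show "f v \<ge> f x - \<eta>" using \<theta>M by (simp add: algebra_simps)
  qed
qed

text \<open>Testing the subgradient inequality with steps of length \<open>\<epsilon> / 2\<close> in
  both directions of an axis bounds that component: the test point has \<open>f \<le> M\<close>, the
  base point has \<open>f \<ge> f x - 1\<close>.\<close>

lemma subdiff_locally_bounded:
  assumes U: "openin (top_of_set (vecs q)) U" and f: "strict_convex_vec_on U f" and x: "x \<in> U"
  shows "\<exists>\<epsilon>>0. \<exists>B. \<forall>v\<in>vecs q. (\<forall>j<q. \<bar>v j - x j\<bar> < \<epsilon>) \<longrightarrow>
    (\<forall>g\<in>subdiff q U f v. \<forall>k<q. \<bar>g k\<bar> \<le> B)"
proof -
  have xq: "x \<in> vecs q" using U x by (auto simp: openin_open)
  obtain \<epsilon> where \<epsilon>: "\<epsilon> > 0" and cube: "\<And>v. v \<in> vecs q \<Longrightarrow> (\<forall>j<q. \<bar>v j - x j\<bar> \<le> \<epsilon>) \<Longrightarrow> v \<in> U"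
    using openin_vecs_contains_cube[OF U x] by blast
  obtain M where M: "\<And>v. v \<in> vecs q \<Longrightarrow> (\<forall>j<q. \<bar>v j - x j\<bar> \<le> \<epsilon>) \<Longrightarrow> f v \<le> M"
    using strict_convex_bounded_above_on_cube[OF f \<epsilon> xq cube] by blast
  obtain \<epsilon>' where \<epsilon>': "\<epsilon>' > 0" and L: "\<And>v. v \<in> vecs q \<Longrightarrow> (\<forall>j<q. \<bar>v j - x j\<bar> \<le> \<epsilon>') \<Longrightarrow> f v \<ge> f x - 1"
    using strict_convex_lower_semicontinuous[OF U f x, of 1] by auto
  show ?thesis
  proof (rule exI[of _ "min \<epsilon>' (\<epsilon> / 2)"], intro exI[of _ "(M - f x + 1) / (\<epsilon> / 2)"] conjI ballI impI allI)
    show "0 < min \<epsilon>' (\<epsilon> / 2)" using \<epsilon> \<epsilon>' by simp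
    fix v g k assume v: "v \<in> vecs q" "\<forall>j<q. \<bar>v j - x j\<bar> < min \<epsilon>' (\<epsilon> / 2)"
      and g: "g \<in> subdiff q U f v" and k: "k < q"
    have fv: "f v \<ge> f x - 1" using v by (intro L) force+
    have step: "g k * h \<le> M - f x + 1" if h: "\<bar>h\<bar> = \<epsilon> / 2" for h
    proof -
      define w where "w = v(k := v k + h)"
      have wq: "w \<in> vecs q" using v(1) k unfolding w_def vecs_def by auto
      have wc: "\<forall>j<q. \<bar>w j - x j\<bar> \<le> \<epsilon>"
      proof (intro allI impI)
        fix j assume "j < q"
        then have "\<bar>v j - x j\<bar> < \<epsilon> / 2" using v(2) by auto
        then show "\<bar>w j - x j\<bar> \<le> \<epsilon>" unfolding w_def using h by auto
      qed
      have "vinner q g (\<lambda>j. w j - v j) = (\<Sum>j<q. if j = k then g k * h else 0)"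
        unfolding vinner_def w_def by (intro sum.cong) auto
      also have "\<dots> = g k * h" using k by simp
      finally have "f v + g k * h \<le> f w" using g cube[OF wq wc] unfolding subdiff_def by auto
      then show ?thesis using M[OF wq wc] fv by linarith
    qed
    show "\<bar>g k\<bar> \<le> (M - f x + 1) / (\<epsilon> / 2)"
      using step[of "\<epsilon> / 2"] step[of "- (\<epsilon> / 2)"] \<epsilon> by (auto simp: field_simps abs_le_iff)
  qed
qed

lemma subdiff_bounded_on_compact:
  assumes U: "openin (top_of_set (vecs q)) U" and f: "strict_convex_vec_on U f"
    and K: "compact K" "K \<subseteq> U"
  shows "\<exists>B. \<forall>v\<in>K. \<forall>g\<in>subdiff q U f v. \<forall>k<q. \<bar>g k\<bar> \<le> B"
proof (rule compact_uniform_bound[OF K(1)])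
  fix x assume "x \<in> K"
  then have x: "x \<in> U" using K by auto
  obtain \<epsilon> B where \<epsilon>: "\<epsilon> > 0" and B: "\<forall>v\<in>vecs q. (\<forall>j<q. \<bar>v j - x j\<bar> < \<epsilon>) \<longrightarrow>
    (\<forall>g\<in>subdiff q U f v. \<forall>k<q. \<bar>g k\<bar> \<le> B)"
    using subdiff_locally_bounded[OF U f x] by blast
  have "K \<subseteq> vecs q" using K U by (auto simp: openin_open)
  with B have "\<forall>v\<in>{v. \<forall>j<q. \<bar>v j - x j\<bar> < \<epsilon>} \<inter> K. \<forall>g\<in>subdiff q U f v. \<forall>k<q. \<bar>g k\<bar> \<le> B"
    by blast
  then show "\<exists>T B. open T \<and> x \<in> T \<and> (\<forall>v\<in>T \<inter> K. \<forall>g\<in>subdiff q U f v. \<forall>k<q. \<bar>g k\<bar> \<le> B)"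
    using \<epsilon> by (intro exI[of _ "{v. \<forall>j<q. \<bar>v j - x j\<bar> < \<epsilon>}"] exI[of _ B])
      (auto simp: open_coordinate_cube)
next
  fix B B' :: real and v
  assume "B \<le> B'" "\<forall>g\<in>subdiff q U f v. \<forall>k<q. \<bar>g k\<bar> \<le> B"
  then show "\<forall>g\<in>subdiff q U f v. \<forall>k<q. \<bar>g k\<bar> \<le> B'" by force
qed

text \<open>A lower semicontinuous function that exceeds \<open>C\<close> on a compact set exceeds
  it by a margin. The margin is written \<open>1 / B\<close> so that the covering lemma for upper
  bounds applies.\<close>

lemma tilted_strict_convex_bounded_below_on_compact:
  assumes U: "openin (top_of_set (vecs q)) U" and f: "strict_convex_vec_on U f"
    and K: "compact K" "K \<subseteq> U"
    and pos: "\<And>v. v \<in> K \<Longrightarrow> f v - (\<Sum>k<q. p k * v k) > C"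
  shows "\<exists>c>0. \<forall>v\<in>K. f v - (\<Sum>k<q. p k * v k) \<ge> C + c"
proof -
  have "\<exists>B. \<forall>v\<in>K. B > 0 \<and> f v - (\<Sum>k<q. p k * v k) \<ge> C + 1 / B"
  proof (rule compact_uniform_bound[OF K(1)])
    fix x assume xK: "x \<in> K"
    then have x: "x \<in> U" using K by auto
    \<comment> \<open>Near \<open>x\<close>, the function and the linear term each cost at most
      \<open>\<eta> / 4\<close>, which leaves the margin \<open>\<eta> / 2\<close>.\<close>
    define \<eta> where "\<eta> = f x - (\<Sum>k<q. p k * x k) - C"
    have \<eta>: "\<eta> > 0" using pos[OF xK] by (simp add: \<eta>_def)
    then obtain \<epsilon> where \<epsilon>: "\<epsilon> > 0" and L: "\<And>v. v \<in> vecs q \<Longrightarrow> (\<forall>j<q. \<bar>v j - x j\<bar> \<le> \<epsilon>) \<Longrightarrow> f v \<ge> f x - \<eta> / 4"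
      using strict_convex_lower_semicontinuous[OF U f x, of "\<eta> / 4"] by auto
    define P where "P = {v :: nat \<Rightarrow> real. (\<Sum>k<q. p k * v k) < (\<Sum>k<q. p k * x k) + \<eta> / 4}"
    have "open P" unfolding P_def by (intro open_Collect_less continuous_intros) auto
    define T where "T = {v. \<forall>j<q. \<bar>v j - x j\<bar> < \<epsilon>} \<inter> P"
    have "open T" unfolding T_def using \<open>open P\<close> open_coordinate_cube by blast
    moreover have "x \<in> T" unfolding T_def P_def using \<epsilon> \<eta> by auto
    moreover have "2 / \<eta> > 0 \<and> f v - (\<Sum>k<q. p k * v k) \<ge> C + 1 / (2 / \<eta>)" if v: "v \<in> T \<inter> K" for v
    proof -
      have "v \<in> vecs q" using v K U by (auto simp: openin_open)
      then have "f v \<ge> f x - \<eta> / 4" using v by (intro L) (auto simp: T_def intro: less_imp_le)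
      then show ?thesis using v \<eta> unfolding T_def P_def \<eta>_def by (auto simp: field_simps)
    qed
    ultimately show "\<exists>T B. open T \<and> x \<in> T \<and>
        (\<forall>v\<in>T \<inter> K. B > 0 \<and> f v - (\<Sum>k<q. p k * v k) \<ge> C + 1 / B)" by blast
  next
    fix B B' :: real and v
    assume B: "B \<le> B'" "B > 0 \<and> f v - (\<Sum>k<q. p k * v k) \<ge> C + 1 / B"
    then have "1 / B' \<le> 1 / B" by (intro divide_left_mono) auto
    with B show "B' > 0 \<and> f v - (\<Sum>k<q. p k * v k) \<ge> C + 1 / B'" by linarith
  qed
  then obtain B where B: "\<And>v. v \<in> K \<Longrightarrow> B > 0 \<and> f v - (\<Sum>k<q. p k * v k) \<ge> C + 1 / B" by blast
  show ?thesis
  proof (cases "K = {}")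
    case True
    then show ?thesis by (auto intro: exI[of _ 1])
  next
    case False
    then show ?thesis using B by (intro exI[of _ "1 / B"]) auto
  qed
qed

subsection \<open>The energy of the projection\<close>

lemma is_proj_le:
  assumes "is_proj k S y p" "z \<in> S"
  shows "(\<Sum>j<k. (y j - p j)\<^sup>2) \<le> (\<Sum>j<k. (y j - z j)\<^sup>2)"
  using assms unfolding is_proj_def vnorm_def by simp

text \<open>Moving from \<open>p\<close> a fraction \<open>s\<close> towards \<open>z\<close>
  changes the squared distance by \<open>-2 s A + s\<^sup>2 B\<close>; minimality of
  \<open>p\<close> excludes \<open>A > 0\<close> for small \<open>s\<close>.\<close>

lemma is_proj_variational:
  assumes S: "convex_vec S" and p: "is_proj k S y p" and z: "z \<in> S"
  shows "(\<Sum>j<k. (y j - p j) * (z j - p j)) \<le> 0"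
proof (rule ccontr)
  define A where "A = (\<Sum>j<k. (y j - p j) * (z j - p j))"
  define B where "B = (\<Sum>j<k. (z j - p j)\<^sup>2)"
  assume "\<not> ?thesis"
  then have A: "A > 0" by (simp add: A_def)
  have B: "B \<ge> 0" unfolding B_def by (simp add: sum_nonneg)
  have key: "2 * s * A \<le> s\<^sup>2 * B" if s: "0 \<le> s" "s \<le> 1" for s
  proof -
    have "(\<lambda>j. s * z j + (1 - s) * p j) \<in> S"
      using S z p s unfolding convex_vec_def is_proj_def by blast
    then have "(\<Sum>j<k. (y j - p j)\<^sup>2) \<le> (\<Sum>j<k. (y j - (s * z j + (1 - s) * p j))\<^sup>2)"
      by (rule is_proj_le[OF p])
    also have "\<dots> = (\<Sum>j<k. (y j - p j)\<^sup>2 - 2 * s * ((y j - p j) * (z j - p j)) + s\<^sup>2 * (z j - p j)\<^sup>2)"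
      by (intro sum.cong refl) (simp add: power2_eq_square algebra_simps)
    also have "\<dots> = (\<Sum>j<k. (y j - p j)\<^sup>2) - 2 * s * A + s\<^sup>2 * B"
      unfolding A_def B_def by (simp add: sum.distrib sum_subtractf sum_distrib_left)
    finally show ?thesis by simp
  qed
  \<comment> \<open>Ensures \<open>s * B \<le> A\<close>, against \<open>2 * A \<le> s * B\<close>
    from \<open>key\<close>.\<close>
  define s where "s = min 1 (A / (B + 1))"
  have s: "0 < s" "s \<le> 1" unfolding s_def using A B by auto
  have "s * B \<le> A / (B + 1) * (B + 1)"
    using A B s unfolding s_def by (intro mult_mono) auto
  then have "s * B \<le> A" using B by simp
  moreover have "2 * A \<le> s * B" using key[of s] s by (simp add: power2_eq_square mult.assoc)
  ultimately show False using A by simp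
qed

text \<open>The variational inequalities at the two projections, each tested at the other, are
  exactly the cross terms of the expanded square.\<close>

lemma is_proj_nonexpansive:
  assumes S: "convex_vec S" and p: "is_proj k S y p" and p': "is_proj k S y' p'"
  shows "(\<Sum>j<k. (p' j - p j)\<^sup>2) \<le> (\<Sum>j<k. (y' j - y j)\<^sup>2)"
proof -
  have 1: "(\<Sum>j<k. (y j - p j) * (p' j - p j)) \<le> 0"
    using is_proj_variational[OF S p] p' unfolding is_proj_def by blast
  have 2: "(\<Sum>j<k. (y' j - p' j) * (p j - p' j)) \<le> 0"
    using is_proj_variational[OF S p'] p unfolding is_proj_def by blast
  have "(\<Sum>j<k. (p' j - p j)\<^sup>2) + (\<Sum>j<k. ((y' j - y j) - (p' j - p j))\<^sup>2) =
    (\<Sum>j<k. (y' j - y j)\<^sup>2) + 2 * (\<Sum>j<k. (y j - p j) * (p' j - p j)) + 2 * (\<Sum>j<k. (y' j - p' j) * (p j - p' j))"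
    unfolding sum_distrib_left sum.distrib[symmetric]
    by (intro sum.cong refl) (simp add: power2_eq_square algebra_simps)
  moreover have "0 \<le> (\<Sum>j<k. ((y' j - y j) - (p' j - p j))\<^sup>2)" by (simp add: sum_nonneg)
  ultimately show ?thesis using 1 2 by linarith
qed

text \<open>As a function of \<open>y\<close> with \<open>x\<close> the projection of \<open>y\<close>, this has gradient \<open>x - c\<close>.\<close>

definition proj_energy :: "nat \<Rightarrow> (nat \<Rightarrow> real) \<Rightarrow> (nat \<Rightarrow> real) \<Rightarrow> (nat \<Rightarrow> real) \<Rightarrow> real" where
  "proj_energy k c y x = (\<Sum>j<k. (y j - c j)\<^sup>2 - (y j - x j)\<^sup>2) / 2"

lemma proj_energy_ge:
  assumes S: "convex_vec S" and p: "is_proj k S y x" and c: "c \<in> S"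
  shows "(\<Sum>j<k. (x j - c j)\<^sup>2) / 2 \<le> proj_energy k c y x"
proof -
  have "2 * proj_energy k c y x = (\<Sum>j<k. (x j - c j)\<^sup>2) - 2 * (\<Sum>j<k. (y j - x j) * (c j - x j))"
    unfolding proj_energy_def sum_distrib_left sum_subtractf[symmetric]
    by (simp, intro sum.cong refl) (simp add: power2_eq_square algebra_simps)
  then show ?thesis using is_proj_variational[OF S p c] by simp
qed

text \<open>A first-order expansion whose remainder involves only the increment of \<open>y\<close>,
  so that nothing about differentiability of the projection is required.\<close>

lemma proj_energy_expansion:
  assumes S: "convex_vec S" and p: "is_proj k S y x" and p': "is_proj k S y' x'"
  shows "\<bar>proj_energy k c y' x' - proj_energy k c y x - (\<Sum>j<k. (x j - c j) * (y' j - y j))\<bar>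
    \<le> (\<Sum>j<k. (y' j - y j)\<^sup>2) / 2"
proof -
  define E where "E = proj_energy k c y' x' - proj_energy k c y x - (\<Sum>j<k. (x j - c j) * (y' j - y j))"
  have E: "2 * E = (\<Sum>j<k. (y' j - c j)\<^sup>2 - (y' j - x' j)\<^sup>2 - ((y j - c j)\<^sup>2 - (y j - x j)\<^sup>2)
      - 2 * ((x j - c j) * (y' j - y j)))"
    unfolding E_def proj_energy_def
    by (simp add: sum_subtractf sum_distrib_left[symmetric] diff_divide_distrib)
  \<comment> \<open>The remainder compares two candidates for the point nearest to
    \<open>y'\<close>, and \<open>x'\<close> wins; hence it is nonnegative.\<close>
  have lo: "2 * E = (\<Sum>j<k. (y' j - x j)\<^sup>2) - (\<Sum>j<k. (y' j - x' j)\<^sup>2)"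
    unfolding E sum_subtractf[symmetric] by (intro sum.cong refl) (simp add: power2_eq_square algebra_simps)
  have "x \<in> S" using p by (simp add: is_proj_def)
  then have "0 \<le> E" using lo is_proj_le[OF p', of x] by simp
  have up: "2 * E = (\<Sum>j<k. (y' j - y j)\<^sup>2) - (\<Sum>j<k. ((y' j - x' j) - (y j - x j))\<^sup>2)
      + 2 * (\<Sum>j<k. (y j - x j) * (x' j - x j))"
    unfolding E sum_subtractf[symmetric] sum_distrib_left sum.distrib[symmetric]
    by (intro sum.cong refl) (simp add: power2_eq_square algebra_simps)
  have "x' \<in> S" using p' by (simp add: is_proj_def)
  then have "2 * E \<le> (\<Sum>j<k. (y' j - y j)\<^sup>2)"
    using up is_proj_variational[OF S p, of x'] sum_nonneg[of "{..<k}" "\<lambda>j. ((y' j - x' j) - (y j - x j))\<^sup>2"]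
    by simp
  then show ?thesis using \<open>0 \<le> E\<close> unfolding E_def[symmetric] by simp
qed

lemma proj_energy_has_derivative:
  fixes y x :: "real \<Rightarrow> nat \<Rightarrow> real"
  assumes S: "convex_vec S" and p: "\<And>s. s \<ge> 0 \<Longrightarrow> is_proj k S (y s) (x s)" and t: "t > 0"
    and y: "\<And>j. j < k \<Longrightarrow> ((\<lambda>s. y s j) has_real_derivative y' j) (at t)"
  shows "((\<lambda>s. proj_energy k c (y s) (x s)) has_real_derivative (\<Sum>j<k. (x t j - c j) * y' j)) (at t)"
proof -
  define L where "L s = proj_energy k c (y t) (x t) + (\<Sum>j<k. (x t j - c j) * (y s j - y t j))" for s
  define R where "R s = (\<Sum>j<k. (y s j - y t j)\<^sup>2) / 2" for s
  have L: "(L has_real_derivative (\<Sum>j<k. (x t j - c j) * y' j)) (at t)"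
    unfolding L_def using y by (auto intro!: derivative_eq_intros sum.cong)
  \<comment> \<open>The remainder bound is quadratic in the increments of \<open>y\<close>, so it is
    negligible against \<open>s - t\<close>.\<close>
  have "(R has_real_derivative 0) (at t)"
    unfolding R_def using y by (auto intro!: derivative_eq_intros sum.neutral)
  then have R: "((\<lambda>s. R s / (s - t)) \<longlongrightarrow> 0) (at t)"
    by (simp add: has_field_derivative_iff R_def)
  define e where "e s = (proj_energy k c (y s) (x s) - L s) / (s - t)" for s
  have "eventually (\<lambda>s. norm (e s) \<le> \<bar>R s / (s - t)\<bar>) (at t)"
  proof -
    have "eventually (\<lambda>s. s > 0) (at t)"
      using order_tendstoD(1)[OF tendsto_ident_at t] by simp
    then show ?thesis
    proof eventually_elim
      case (elim s)
      have "\<bar>proj_energy k c (y s) (x s) - L s\<bar> \<le> \<bar>R s\<bar>"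
        using proj_energy_expansion[OF S p[of t] p[of s], of c] t elim unfolding L_def R_def
        by (simp add: algebra_simps)
      then show ?case unfolding e_def by (simp add: divide_right_mono)
    qed
  qed
  then have e: "(e \<longlongrightarrow> 0) (at t)"
    by (rule Lim_null_comparison) (use R tendsto_rabs_zero in blast)
  have "((\<lambda>s. (L s - L t) / (s - t) + e s) \<longlongrightarrow> (\<Sum>j<k. (x t j - c j) * y' j) + 0) (at t)"
    using L e by (intro tendsto_add) (auto simp: has_field_derivative_iff)
  moreover have "(L s - L t) / (s - t) + e s =
      (proj_energy k c (y s) (x s) - proj_energy k c (y t) (x t)) / (s - t)" for s
    unfolding e_def by (simp add: L_def diff_divide_distrib add_divide_distrib)
  ultimately show ?thesis by (simp add: has_field_derivative_iff)
qed

lemma is_proj_self: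
  assumes "c \<in> S"
  shows "is_proj k S c c"
  using assms unfolding is_proj_def vnorm_def by (simp add: sum_nonneg)

lemma is_proj_coordinate_le:
  assumes S: "convex_vec S" and p: "is_proj k S y p" and p': "is_proj k S y' p'" and j: "j < k"
  shows "\<bar>p' j - p j\<bar> \<le> (\<Sum>i<k. \<bar>y' i - y i\<bar>)"
proof -
  have "\<bar>p' j - p j\<bar> \<le> L2_set (\<lambda>i. p' i - p i) {..<k}"
    using member_le_L2_set[of "{..<k}" j "\<lambda>i. \<bar>p' i - p i\<bar>"] j by (simp add: L2_set_def)
  also have "\<dots> \<le> L2_set (\<lambda>i. y' i - y i) {..<k}"
    unfolding L2_set_def using is_proj_nonexpansive[OF S p p'] by simp
  also have "\<dots> \<le> (\<Sum>i<k. \<bar>y' i - y i\<bar>)" by (rule L2_set_le_sum_abs)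
  finally show ?thesis .
qed

lemma proj_energy_abs_cont_on:
  fixes y x :: "real \<Rightarrow> nat \<Rightarrow> real"
  assumes S: "convex_vec S" and c: "c \<in> S" and p: "\<And>s. s \<in> {a..b} \<Longrightarrow> is_proj k S (y s) (x s)"
    and ac: "\<And>j. j < k \<Longrightarrow> abs_cont_on {a..b} (\<lambda>s. y s j)"
  shows "abs_cont_on {a..b} (\<lambda>s. proj_energy k c (y s) (x s))"
proof -
  have "\<forall>j. \<exists>B. j < k \<longrightarrow> (\<forall>s\<in>{a..b}. \<bar>y s j\<bar> \<le> B)"
    using abs_cont_on_bounded[OF ac] by metis
  then obtain B where B: "\<And>j s. j < k \<Longrightarrow> s \<in> {a..b} \<Longrightarrow> \<bar>y s j\<bar> \<le> B j" by metis
  \<comment> \<open>Bounds the deviation of \<open>y\<close> from \<open>c\<close>, hence also that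
    of \<open>x\<close>, because \<open>c\<close> is its own projection. The linear part and the
    halved quadratic part each contribute a factor \<open>C\<close>, whence \<open>2 * C\<close>
    below.\<close>
  define C where "C = (\<Sum>j<k. B j + \<bar>c j\<bar>)"
  have yC: "(\<Sum>j<k. \<bar>y s j - c j\<bar>) \<le> C" if "s \<in> {a..b}" for s
    unfolding C_def
  proof (rule sum_mono)
    show "\<bar>y s j - c j\<bar> \<le> B j + \<bar>c j\<bar>" if "j \<in> {..<k}" for j
      using B[of j s] that \<open>s \<in> {a..b}\<close> by fastforce
  qed
  have xC: "\<bar>x s j - c j\<bar> \<le> C" if "s \<in> {a..b}" "j < k" for s j
    using is_proj_coordinate_le[OF S is_proj_self[OF c] p[OF that(1)] that(2)] yC[OF that(1)] by linarith
  have yC1: "\<bar>y s j - c j\<bar> \<le> C" if "s \<in> {a..b}" "j < k" for s j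
    using member_le_sum[of j "{..<k}" "\<lambda>j. \<bar>y s j - c j\<bar>"] yC[OF that(1)] that(2) by force
  show ?thesis
  proof (rule abs_cont_on_dominated[where K = "{..<k}" and F = "\<lambda>j s. y s j" and C = "2 * C"])
    fix u v assume uv: "u \<in> {a..b}" "v \<in> {a..b}"
    have "\<bar>proj_energy k c (y v) (x v) - proj_energy k c (y u) (x u)\<bar>
      \<le> \<bar>\<Sum>j<k. (x u j - c j) * (y v j - y u j)\<bar> + (\<Sum>j<k. (y v j - y u j)\<^sup>2) / 2"
      using proj_energy_expansion[OF S p[OF uv(1)] p[OF uv(2)], of c] by linarith
    also have "\<bar>\<Sum>j<k. (x u j - c j) * (y v j - y u j)\<bar> \<le> (\<Sum>j<k. C * \<bar>y v j - y u j\<bar>)"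
    proof (rule order_trans[OF sum_abs], rule sum_mono)
      show "\<bar>(x u j - c j) * (y v j - y u j)\<bar> \<le> C * \<bar>y v j - y u j\<bar>" if "j \<in> {..<k}" for j
        unfolding abs_mult using xC[OF uv(1)] that by (intro mult_right_mono) auto
    qed
    also have "(\<Sum>j<k. (y v j - y u j)\<^sup>2) \<le> (\<Sum>j<k. 2 * C * \<bar>y v j - y u j\<bar>)"
    proof (rule sum_mono)
      fix j assume "j \<in> {..<k}"
      then have "\<bar>y v j - y u j\<bar> \<le> 2 * C" using yC1[OF uv(1), of j] yC1[OF uv(2), of j] by simp
      then have "\<bar>y v j - y u j\<bar> * \<bar>y v j - y u j\<bar> \<le> 2 * C * \<bar>y v j - y u j\<bar>"
        by (rule mult_right_mono) simp
      then show "(y v j - y u j)\<^sup>2 \<le> 2 * C * \<bar>y v j - y u j\<bar>" by (simp add: power2_eq_square)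
    qed
    finally show "\<bar>proj_energy k c (y v) (x v) - proj_energy k c (y u) (x u)\<bar>
        \<le> 2 * C * (\<Sum>j<k. \<bar>y v j - y u j\<bar>)"
      by (simp add: sum_distrib_left[symmetric] mult.assoc)
  qed (use ac in auto)
qed

subsection \<open>The saddle-point flow\<close>

lemma matT_vec_pairing:
  "(\<Sum>k<c. matT_vec r c M w k * v k) = (\<Sum>i<r. w i * (\<Sum>k<c. M i k * v k))"
proof -
  have "(\<Sum>k<c. matT_vec r c M w k * v k) = (\<Sum>k<c. \<Sum>i<r. w i * (M i k * v k))"
    by (intro sum.cong) (auto simp: matT_vec_def sum_distrib_right sum_distrib_left mult_ac)
  also have "\<dots> = (\<Sum>i<r. w i * (\<Sum>k<c. M i k * v k))"
    by (subst sum.swap) (simp add: sum_distrib_left)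
  finally show ?thesis .
qed

lemma vnorm_uniformly_bounded:
  fixes u :: "real \<Rightarrow> nat \<Rightarrow> nat \<Rightarrow> real"
  assumes "\<And>i k. i < n \<Longrightarrow> k < N i \<Longrightarrow> \<exists>B. \<forall>t\<ge>0. \<bar>u t i k\<bar> \<le> B"
  shows "\<exists>B. \<forall>t\<ge>0. \<forall>i<n. vnorm (N i) (u t i) \<le> B"
proof -
  obtain B where B: "\<And>i k t. i < n \<Longrightarrow> k < N i \<Longrightarrow> t \<ge> 0 \<Longrightarrow> \<bar>u t i k\<bar> \<le> B i k"
    using assms by metis
  show ?thesis
  proof (intro exI[of _ "\<Sum>i<n. \<Sum>k<N i. \<bar>B i k\<bar>"] allI impI)
    fix t :: real and i assume t: "t \<ge> 0" and i: "i < n"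
    have "vnorm (N i) (u t i) \<le> (\<Sum>k<N i. \<bar>u t i k\<bar>)"
      using L2_set_le_sum_abs[of "u t i" "{..<N i}"] by (simp add: vnorm_def L2_set_def)
    also have "\<dots> \<le> (\<Sum>k<N i. \<bar>B i k\<bar>)"
      using B[OF i _ t] by (intro sum_mono) force
    also have "\<dots> \<le> (\<Sum>i<n. \<Sum>k<N i. \<bar>B i k\<bar>)"
      using i by (intro member_le_sum) (auto intro: sum_nonneg)
    finally show "vnorm (N i) (u t i) \<le> (\<Sum>i<n. \<Sum>k<N i. \<bar>B i k\<bar>)" .
  qed
qed

text \<open>The last three assumptions are the optimality conditions: feasible blocks, blockwise
  minimality of the Lagrangian, and a \<open>zs\<close> that balances the local residuals. They are
  the form in which Slater's condition and connectedness reach the analysis of the flow.\<close>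

locale saddle_flow =
  fixes n m :: nat and q :: "nat \<Rightarrow> nat"
    and a :: "nat \<Rightarrow> nat \<Rightarrow> real"
    and \<Omega> U :: "nat \<Rightarrow> (nat \<Rightarrow> real) set"
    and f :: "nat \<Rightarrow> (nat \<Rightarrow> real) \<Rightarrow> real"
    and W :: "nat \<Rightarrow> nat \<Rightarrow> nat \<Rightarrow> real"
    and d :: "nat \<Rightarrow> nat \<Rightarrow> real"
    and y x lam z :: "real \<Rightarrow> nat \<Rightarrow> nat \<Rightarrow> real"
    and xs :: "nat \<Rightarrow> nat \<Rightarrow> real" and \<mu> :: "nat \<Rightarrow> real" and zs :: "nat \<Rightarrow> nat \<Rightarrow> real"
  assumes a_sym: "\<And>i j. a i j = a j i"
    and a_nonneg: "\<And>i j. a i j \<ge> 0"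
    and \<Omega>_sub: "\<And>i. i < n \<Longrightarrow> \<Omega> i \<subseteq> vecs (q i)"
    and \<Omega>_closed: "\<And>i. i < n \<Longrightarrow> closed (\<Omega> i)"
    and \<Omega>_convex: "\<And>i. i < n \<Longrightarrow> convex_vec (\<Omega> i)"
    and U_open: "\<And>i. i < n \<Longrightarrow> openin (top_of_set (vecs (q i))) (U i)"
    and \<Omega>_U: "\<And>i. i < n \<Longrightarrow> \<Omega> i \<subseteq> U i"
    and f_strict: "\<And>i. i < n \<Longrightarrow> strict_convex_vec_on (U i) (f i)"
    and sol_proj: "\<And>t i. t \<ge> 0 \<Longrightarrow> i < n \<Longrightarrow> is_proj (q i) (\<Omega> i) (y t i) (x t i)"
    and ac_y: "\<And>i k. i < n \<Longrightarrow> k < q i \<Longrightarrow> abs_cont_nonneg (\<lambda>t. y t i k)"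
    and ac_lam: "\<And>i r. i < n \<Longrightarrow> r < m \<Longrightarrow> abs_cont_nonneg (\<lambda>t. lam t i r)"
    and ac_z: "\<And>i r. i < n \<Longrightarrow> r < m \<Longrightarrow> abs_cont_nonneg (\<lambda>t. z t i r)"
    and dyn: "AE t in lborel. t > 0 \<longrightarrow> (\<forall>i<n.
          (\<exists>g\<in>subdiff (q i) (U i) (f i) (x t i). \<forall>k<q i.
              ((\<lambda>s. y s i k) has_real_derivative
                 (- y t i k + x t i k - g k + matT_vec m (q i) (W i) (lam t i) k)) (at t)) \<and>
          (\<forall>r<m. ((\<lambda>s. lam s i r) has_real_derivative
                 (d i r - mat_vec m (q i) (W i) (x t i) r
                  - laplacian n a (\<lambda>j. lam t j r) i - laplacian n a (\<lambda>j. z t j r) i)) (at t)) \<and>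
          (\<forall>r<m. ((\<lambda>s. z s i r) has_real_derivative laplacian n a (\<lambda>j. lam t j r) i) (at t)))"
    and xs_mem: "\<And>i. i < n \<Longrightarrow> xs i \<in> \<Omega> i"
    and xs_min: "\<And>i u. i < n \<Longrightarrow> u \<in> \<Omega> i \<Longrightarrow>
        f i (xs i) - (\<Sum>k<q i. matT_vec m (q i) (W i) \<mu> k * xs i k)
        \<le> f i u - (\<Sum>k<q i. matT_vec m (q i) (W i) \<mu> k * u k)"
    and zs: "\<And>i r. i < n \<Longrightarrow> r < m \<Longrightarrow>
        laplacian n a (\<lambda>j. zs j r) i = d i r - mat_vec m (q i) (W i) (xs i) r"
begin

text \<open>One agent's share of the Lagrangian gap at the multiplier \<open>\<mu>\<close>; the
  Lagrangian is separable across agents.\<close>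

definition gap :: "nat \<Rightarrow> (nat \<Rightarrow> real) \<Rightarrow> real" where
  "gap i u = f i u - (\<Sum>k<q i. matT_vec m (q i) (W i) \<mu> k * u k)
    - (f i (xs i) - (\<Sum>k<q i. matT_vec m (q i) (W i) \<mu> k * xs i k))"

definition lyap :: "real \<Rightarrow> real" where
  "lyap t = (\<Sum>i<n. proj_energy (q i) (xs i) (y t i) (x t i)
     + ((\<Sum>r<m. (lam t i r - \<mu> r)\<^sup>2 / 2) + (\<Sum>r<m. (z t i r - zs i r)\<^sup>2 / 2)))"

lemma x_mem: "t \<ge> 0 \<Longrightarrow> i < n \<Longrightarrow> x t i \<in> \<Omega> i"
  using sol_proj by (simp add: is_proj_def)

lemma gap_nonneg: "i < n \<Longrightarrow> u \<in> \<Omega> i \<Longrightarrow> gap i u \<ge> 0"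
  using xs_min unfolding gap_def by force

text \<open>A second minimiser would give a midpoint with negative gap, by strict convexity.\<close>

lemma gap_pos:
  assumes i: "i < n" and u: "u \<in> \<Omega> i" and ne: "u \<noteq> xs i"
  shows "gap i u > 0"
proof -
  define w where "w = (\<lambda>j. 1/2 * u j + (1 - 1/2) * xs i j)"
  have "w \<in> \<Omega> i"
    using \<Omega>_convex[OF i, unfolded convex_vec_def, rule_format, OF u xs_mem[OF i], of "1/2"]
    unfolding w_def by simp
  then have "0 \<le> gap i w" by (rule gap_nonneg[OF i])
  moreover have "f i w < 1/2 * f i u + (1 - 1/2) * f i (xs i)"
    using f_strict[OF i, unfolded strict_convex_vec_on_def, rule_format, of u "xs i" "1/2"] u ne
      xs_mem[OF i] \<Omega>_U[OF i] unfolding w_def by auto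
  moreover have "(\<Sum>k<q i. matT_vec m (q i) (W i) \<mu> k * w k) =
      1/2 * (\<Sum>k<q i. matT_vec m (q i) (W i) \<mu> k * u k) + 1/2 * (\<Sum>k<q i. matT_vec m (q i) (W i) \<mu> k * xs i k)"
    unfolding w_def sum_distrib_left sum.distrib[symmetric] by (intro sum.cong) (auto simp: algebra_simps)
  ultimately show ?thesis unfolding gap_def by simp
qed

section \<open>Dissipation of the Lyapunov function\<close>

lemma lyap_abs_cont:
  assumes "0 \<le> s"
  shows "abs_cont_on {s..t} lyap"
proof (cases "s \<le> t")
  case True
  have sub: "abs_cont_nonneg h \<Longrightarrow> abs_cont_on {s..t} h" for h
    using assms True abs_cont_on_subset[of "{0..t}" h "{s..t}"] by (auto simp: abs_cont_nonneg_def)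
  have sq: "abs_cont_on {s..t} (\<lambda>t. (h t - c)\<^sup>2 / 2)" if "abs_cont_nonneg h" for h c
  proof -
    have "abs_cont_on {s..t} (\<lambda>t. (h t + - c) * (h t + - c) * (1 / 2))"
      by (intro abs_cont_on_mult abs_cont_on_add abs_cont_on_const sub that)
    then show ?thesis by (simp add: power2_eq_square)
  qed
  show ?thesis unfolding lyap_def[abs_def]
  proof (intro abs_cont_on_sum abs_cont_on_add finite_lessThan sq ac_lam ac_z)
    fix i assume "i \<in> {..<n}"
    then have i: "i < n" by simp
    show "abs_cont_on {s..t} (\<lambda>t. proj_energy (q i) (xs i) (y t i) (x t i))"
      using assms by (intro proj_energy_abs_cont_on[OF \<Omega>_convex[OF i] xs_mem[OF i]] sol_proj i sub ac_y) auto
  qed auto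
next
  case False
  then show ?thesis by (auto intro: abs_cont_on_lipschitz)
qed

text \<open>The projection term is nonpositive by the variational inequality and the subgradient
  term is bounded by its inequality at \<open>xs\<close>. The coupling with
  \<open>lam - \<mu>\<close> remains and is cancelled by the dual part.\<close>

lemma primal_dissipation:
  assumes i: "i < n" and t: "t \<ge> 0" and g: "g \<in> subdiff (q i) (U i) (f i) (x t i)"
  shows "(\<Sum>k<q i. (x t i k - xs i k) * (- y t i k + x t i k - g k + matT_vec m (q i) (W i) (lam t i) k))
    \<le> - gap i (x t i) + (\<Sum>r<m. (lam t i r - \<mu> r) * (\<Sum>k<q i. W i r k * (x t i k - xs i k)))"
proof -
  define v where "v k = x t i k - xs i k" for k
  have "(\<Sum>k<q i. (x t i k - xs i k) * (- y t i k + x t i k - g k + matT_vec m (q i) (W i) (lam t i) k))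
    = (\<Sum>k<q i. (y t i k - x t i k) * (xs i k - x t i k)) + (\<Sum>k<q i. g k * (xs i k - x t i k))
      + (\<Sum>k<q i. matT_vec m (q i) (W i) (lam t i) k * v k)"
    unfolding sum.distrib[symmetric] v_def by (intro sum.cong) (auto simp: algebra_simps)
  also have "\<dots> \<le> 0 + (f i (xs i) - f i (x t i)) + (\<Sum>k<q i. matT_vec m (q i) (W i) (lam t i) k * v k)"
  proof (intro add_mono order_refl)
    show "(\<Sum>k<q i. (y t i k - x t i k) * (xs i k - x t i k)) \<le> 0"
      by (rule is_proj_variational[OF \<Omega>_convex[OF i] sol_proj[OF t i] xs_mem[OF i]])
    have "xs i \<in> U i" using xs_mem[OF i] \<Omega>_U[OF i] by auto
    then show "(\<Sum>k<q i. g k * (xs i k - x t i k)) \<le> f i (xs i) - f i (x t i)"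
      using g unfolding subdiff_def vinner_def by auto
  qed
  also have "\<dots> = - gap i (x t i) + (\<Sum>k<q i. matT_vec m (q i) (W i) (lam t i) k * v k)
      - (\<Sum>k<q i. matT_vec m (q i) (W i) \<mu> k * v k)"
    unfolding gap_def v_def by (simp add: right_diff_distrib sum_subtractf)
  also have "\<dots> = - gap i (x t i) + (\<Sum>r<m. (lam t i r - \<mu> r) * (\<Sum>k<q i. W i r k * v k))"
    unfolding matT_vec_pairing by (simp add: left_diff_distrib sum_subtractf)
  finally show ?thesis unfolding v_def .
qed

text \<open>The quadratic form of the Laplacian in \<open>lam - \<mu>\<close> is nonnegative and
  enters with a minus sign; the cross terms with \<open>z - zs\<close> cancel by self-adjointness,
  which is why \<open>z\<close> enters the dynamics skew-symmetrically.\<close>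

lemma dual_dissipation:
  assumes r: "r < m"
  shows "(\<Sum>i<n. (lam t i r - \<mu> r) * (d i r - mat_vec m (q i) (W i) (x t i) r
        - laplacian n a (\<lambda>j. lam t j r) i - laplacian n a (\<lambda>j. z t j r) i)
      + (z t i r - zs i r) * laplacian n a (\<lambda>j. lam t j r) i)
    \<le> - (\<Sum>i<n. (lam t i r - \<mu> r) * (\<Sum>k<q i. W i r k * (x t i k - xs i k)))"
proof -
  define u where "u i = lam t i r - \<mu> r" for i
  define v where "v i = z t i r - zs i r" for i
  \<comment> \<open>The target \<open>\<mu>\<close> is the same for all agents, so the Laplacian
    does not see it.\<close>
  have Lu: "laplacian n a (\<lambda>j. lam t j r) i = laplacian n a u i" for i
    unfolding laplacian_def u_def by simp
  have Lv: "laplacian n a v i = laplacian n a (\<lambda>j. z t j r) i - laplacian n a (\<lambda>j. zs j r) i" for i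
    using laplacian_linear[of n a 1 "\<lambda>j. z t j r" "-1" "\<lambda>j. zs j r"] unfolding v_def by simp
  have "(\<Sum>i<n. (lam t i r - \<mu> r) * (d i r - mat_vec m (q i) (W i) (x t i) r
        - laplacian n a (\<lambda>j. lam t j r) i - laplacian n a (\<lambda>j. z t j r) i)
      + (z t i r - zs i r) * laplacian n a (\<lambda>j. lam t j r) i)
    = (\<Sum>i<n. - (u i * (\<Sum>k<q i. W i r k * (x t i k - xs i k))) - u i * laplacian n a u i
        - u i * laplacian n a v i + v i * laplacian n a u i)"
  proof (intro sum.cong refl)
    fix i assume "i \<in> {..<n}"
    then have "d i r = mat_vec m (q i) (W i) (xs i) r + laplacian n a (\<lambda>j. zs j r) i"
      using zs[of i r] r by simp
    moreover have "mat_vec m (q i) (W i) (x t i) r - mat_vec m (q i) (W i) (xs i) r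
        = (\<Sum>k<q i. W i r k * (x t i k - xs i k))"
      using r by (simp add: mat_vec_def right_diff_distrib sum_subtractf)
    ultimately have e: "d i r - mat_vec m (q i) (W i) (x t i) r
        - laplacian n a (\<lambda>j. lam t j r) i - laplacian n a (\<lambda>j. z t j r) i
      = - (\<Sum>k<q i. W i r k * (x t i k - xs i k)) - laplacian n a u i - laplacian n a v i"
      unfolding Lu Lv by simp
    show "(lam t i r - \<mu> r) * (d i r - mat_vec m (q i) (W i) (x t i) r
        - laplacian n a (\<lambda>j. lam t j r) i - laplacian n a (\<lambda>j. z t j r) i)
      + (z t i r - zs i r) * laplacian n a (\<lambda>j. lam t j r) i
      = - (u i * (\<Sum>k<q i. W i r k * (x t i k - xs i k))) - u i * laplacian n a u i
        - u i * laplacian n a v i + v i * laplacian n a u i"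
      unfolding e unfolding Lu u_def[symmetric] v_def[symmetric] by (simp add: right_diff_distrib)
  qed
  also have "\<dots> = - (\<Sum>i<n. u i * (\<Sum>k<q i. W i r k * (x t i k - xs i k))) - (\<Sum>i<n. u i * laplacian n a u i)
      - (\<Sum>i<n. u i * laplacian n a v i) + (\<Sum>i<n. v i * laplacian n a u i)"
    by (simp add: sum.distrib sum_subtractf sum_negf)
  also have "\<dots> \<le> - (\<Sum>i<n. u i * (\<Sum>k<q i. W i r k * (x t i k - xs i k)))"
    using laplacian_form_nonneg[of a u n, OF a_sym a_nonneg] laplacian_self_adjoint[of a u n v, OF a_sym]
    by simp
  finally show ?thesis unfolding u_def .
qed

lemma lyap_derivative:
  "AE t in lborel. t > 0 \<longrightarrow> (\<exists>D \<le> - (\<Sum>i<n. gap i (x t i)). (lyap has_real_derivative D) (at t))"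
  using dyn
proof eventually_elim
  case (elim t)
  show ?case
  proof
    assume t: "t > 0"
    \<comment> \<open>The subgradients are chosen at this one \<open>t\<close>; their dependence on
      time never matters.\<close>
    have "\<forall>i. \<exists>g. i < n \<longrightarrow> g \<in> subdiff (q i) (U i) (f i) (x t i) \<and> (\<forall>k<q i.
              ((\<lambda>s. y s i k) has_real_derivative
                 (- y t i k + x t i k - g k + matT_vec m (q i) (W i) (lam t i) k)) (at t))"
      using elim t by blast
    then obtain g where g: "\<And>i. i < n \<Longrightarrow> g i \<in> subdiff (q i) (U i) (f i) (x t i)"
      and dy: "\<And>i k. i < n \<Longrightarrow> k < q i \<Longrightarrow> ((\<lambda>s. y s i k) has_real_derivative
                 (- y t i k + x t i k - g i k + matT_vec m (q i) (W i) (lam t i) k)) (at t)"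
      by metis
    define l' where "l' i r = d i r - mat_vec m (q i) (W i) (x t i) r
                  - laplacian n a (\<lambda>j. lam t j r) i - laplacian n a (\<lambda>j. z t j r) i" for i r
    define z' where "z' i r = laplacian n a (\<lambda>j. lam t j r) i" for i r
    have dl: "((\<lambda>s. lam s i r) has_real_derivative l' i r) (at t)"
      and dz: "((\<lambda>s. z s i r) has_real_derivative z' i r) (at t)" if "i < n" "r < m" for i r
      using elim t that unfolding l'_def z'_def by auto
    define P where "P i = (\<Sum>k<q i. (x t i k - xs i k) * (- y t i k + x t i k - g i k + matT_vec m (q i) (W i) (lam t i) k))" for i
    define D where "D = (\<Sum>i<n. P i + ((\<Sum>r<m. (lam t i r - \<mu> r) * l' i r) + (\<Sum>r<m. (z t i r - zs i r) * z' i r)))"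
    have sq: "((\<lambda>s. (h s - c)\<^sup>2 / 2) has_real_derivative (h t - c) * h') (at t)"
      if "(h has_real_derivative h') (at t)" for h :: "real \<Rightarrow> real" and h' c
      using that by (auto intro!: derivative_eq_intros)
    have "(lyap has_real_derivative D) (at t)"
      unfolding lyap_def[abs_def] D_def
    proof (intro DERIV_sum DERIV_add sq)
      fix i assume "i \<in> {..<n}"
      then have i: "i < n" by simp
      show "((\<lambda>s. proj_energy (q i) (xs i) (y s i) (x s i)) has_real_derivative P i) (at t)"
        unfolding P_def by (intro proj_energy_has_derivative[OF \<Omega>_convex[OF i]] sol_proj i t dy)
    qed (auto intro: dl dz)
    moreover have "D \<le> - (\<Sum>i<n. gap i (x t i))"
    proof -
      \<comment> \<open>The primal-dual coupling, which occurs with opposite signs in the two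
        estimates.\<close>
      define w where "w i r = (lam t i r - \<mu> r) * (\<Sum>k<q i. W i r k * (x t i k - xs i k))" for i r
      have "D = (\<Sum>i<n. P i) + (\<Sum>r<m. \<Sum>i<n. (lam t i r - \<mu> r) * l' i r + (z t i r - zs i r) * z' i r)"
        unfolding D_def sum.distrib by (simp add: sum.swap[of _ "{..<m}"])
      also have "\<dots> \<le> (\<Sum>i<n. - gap i (x t i) + (\<Sum>r<m. w i r)) + (\<Sum>r<m. - (\<Sum>i<n. w i r))"
      proof (intro add_mono sum_mono)
        show "P i \<le> - gap i (x t i) + (\<Sum>r<m. w i r)" if "i \<in> {..<n}" for i
          unfolding P_def w_def using primal_dissipation[OF _ _ g] that t by auto
        show "(\<Sum>i<n. (lam t i r - \<mu> r) * l' i r + (z t i r - zs i r) * z' i r) \<le> - (\<Sum>i<n. w i r)"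
          if "r \<in> {..<m}" for r
          unfolding l'_def z'_def w_def using dual_dissipation that by auto
      qed
      also have "\<dots> = - (\<Sum>i<n. gap i (x t i))"
        by (simp add: sum.distrib sum_negf sum.swap[of _ "{..<m}"] sum_subtractf)
      finally show ?thesis .
    qed
    ultimately show "\<exists>D \<le> - (\<Sum>i<n. gap i (x t i)). (lyap has_real_derivative D) (at t)" by blast
  qed
qed

lemma lyap_decrease:
  assumes st: "0 \<le> s" "s \<le> t" and c: "\<And>r. s < r \<Longrightarrow> r < t \<Longrightarrow> c \<le> (\<Sum>i<n. gap i (x r i))"
  shows "lyap t \<le> lyap s - c * (t - s)"
proof -
  have "lyap t \<le> lyap s + (- c) * (t - s)"
  proof (rule abs_cont_on_decrease[OF st(2) lyap_abs_cont[OF st(1)]])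
    show "AE r in lborel. s < r \<and> r < t \<longrightarrow> (\<exists>D\<le>- c. (lyap has_real_derivative D) (at r))"
      using lyap_derivative
    proof eventually_elim
      case (elim r)
      show ?case
      proof
        assume r: "s < r \<and> r < t"
        then obtain D where "D \<le> - (\<Sum>i<n. gap i (x r i))" "(lyap has_real_derivative D) (at r)"
          using elim st by auto
        then show "\<exists>D\<le>- c. (lyap has_real_derivative D) (at r)" using c[of r] r by (intro exI[of _ D]) auto
      qed
    qed
  qed
  then show ?thesis by simp
qed

lemma lyap_antimono:
  assumes "0 \<le> s" "s \<le> t"
  shows "lyap t \<le> lyap s"
proof -
  have "lyap t \<le> lyap s - 0 * (t - s)"
    by (rule lyap_decrease[OF assms]) (use gap_nonneg x_mem assms in \<open>auto intro!: sum_nonneg\<close>)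
  then show ?thesis by simp
qed

lemma lyap_ge:
  assumes t: "t \<ge> 0" and i: "i < n"
  shows "(\<Sum>k<q i. (x t i k - xs i k)\<^sup>2) / 2 + ((\<Sum>r<m. (lam t i r - \<mu> r)\<^sup>2 / 2) + (\<Sum>r<m. (z t i r - zs i r)\<^sup>2 / 2)) \<le> lyap t"
proof -
  define h where "h i = proj_energy (q i) (xs i) (y t i) (x t i)
     + ((\<Sum>r<m. (lam t i r - \<mu> r)\<^sup>2 / 2) + (\<Sum>r<m. (z t i r - zs i r)\<^sup>2 / 2))" for i
  have ge: "(\<Sum>k<q i. (x t i k - xs i k)\<^sup>2) / 2 \<le> proj_energy (q i) (xs i) (y t i) (x t i)" if "i < n" for i
    by (rule proj_energy_ge[OF \<Omega>_convex[OF that] sol_proj[OF t that] xs_mem[OF that]])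
  have "0 \<le> h i" if "i < n" for i
  proof -
    have "0 \<le> (\<Sum>k<q i. (x t i k - xs i k)\<^sup>2) / 2" by (simp add: sum_nonneg)
    then have "0 \<le> proj_energy (q i) (xs i) (y t i) (x t i)" using ge[OF that] by linarith
    then show ?thesis unfolding h_def by (intro add_nonneg_nonneg sum_nonneg) auto
  qed
  then have "h i \<le> (\<Sum>i<n. h i)" using i by (intro member_le_sum) auto
  then show ?thesis using ge[OF i] unfolding lyap_def h_def by linarith
qed

lemma lyap_nonneg:
  assumes "t \<ge> 0"
  shows "lyap t \<ge> 0"
proof (cases "n = 0")
  case True
  then show ?thesis unfolding lyap_def by simp
next
  case False
  then have "0 < n" by simp
  have "0 \<le> (\<Sum>k<q 0. (x t 0 k - xs 0 k)\<^sup>2) / 2 + ((\<Sum>r<m. (lam t 0 r - \<mu> r)\<^sup>2 / 2) + (\<Sum>r<m. (z t 0 r - zs 0 r)\<^sup>2 / 2))"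
    by (intro add_nonneg_nonneg sum_nonneg divide_nonneg_nonneg) auto
  then show ?thesis using lyap_ge[OF assms \<open>0 < n\<close>] by linarith
qed

section \<open>Boundedness and convergence of the trajectory\<close>

definition radius :: real where
  "radius = sqrt (2 * lyap 0)"

lemma deviations_le_radius:
  assumes t: "t \<ge> 0" and i: "i < n"
  shows "k < q i \<Longrightarrow> \<bar>x t i k - xs i k\<bar> \<le> radius"
    and "r < m \<Longrightarrow> \<bar>lam t i r - \<mu> r\<bar> \<le> radius"
    and "r < m \<Longrightarrow> \<bar>z t i r - zs i r\<bar> \<le> radius"
proof -
  have X: "0 \<le> (\<Sum>k<q i. (x t i k - xs i k)\<^sup>2) / 2" and L: "0 \<le> (\<Sum>r<m. (lam t i r - \<mu> r)\<^sup>2 / 2)"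
    and Z: "0 \<le> (\<Sum>r<m. (z t i r - zs i r)\<^sup>2 / 2)" by (simp_all add: sum_nonneg)
  have V: "(\<Sum>k<q i. (x t i k - xs i k)\<^sup>2) / 2 + ((\<Sum>r<m. (lam t i r - \<mu> r)\<^sup>2 / 2) + (\<Sum>r<m. (z t i r - zs i r)\<^sup>2 / 2)) \<le> lyap 0"
    using lyap_ge[OF t i] lyap_antimono[of 0 t] t by linarith
  \<comment> \<open>The energy dominates half of each squared deviation and never exceeds its
    initial value; this is the origin of the 2 in \<open>radius\<close>.\<close>
  have root: "\<bar>v\<bar> \<le> radius" if "v\<^sup>2 \<le> 2 * lyap 0" for v
    unfolding radius_def using real_sqrt_le_mono[OF that] by simp
  show "\<bar>x t i k - xs i k\<bar> \<le> radius" if "k < q i"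
    using member_le_sum[of k "{..<q i}" "\<lambda>k. (x t i k - xs i k)\<^sup>2"] that X L Z V by (intro root) auto
  show "\<bar>lam t i r - \<mu> r\<bar> \<le> radius" if "r < m"
    using member_le_sum[of r "{..<m}" "\<lambda>r. (lam t i r - \<mu> r)\<^sup>2 / 2"] that X L Z V by (intro root) auto
  show "\<bar>z t i r - zs i r\<bar> \<le> radius" if "r < m"
    using member_le_sum[of r "{..<m}" "\<lambda>r. (z t i r - zs i r)\<^sup>2 / 2"] that X L Z V by (intro root) auto
qed

text \<open>Each coordinate of \<open>y\<close> solves a scalar relaxation equation. Its forcing is
  bounded because \<open>x\<close> stays in a compact part of \<open>\<Omega> i\<close>, where the
  subgradients are bounded, and \<open>lam\<close> is bounded.\<close>

lemma y_bounded_lipschitz: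
  assumes i: "i < n" and k: "k < q i"
  shows "\<exists>B. (\<forall>t\<ge>0. \<bar>y t i k\<bar> \<le> B) \<and> (\<forall>s\<ge>0. \<forall>t\<ge>0. \<bar>y t i k - y s i k\<bar> \<le> B * \<bar>t - s\<bar>)"
proof -
  define K where "K = \<Omega> i \<inter> {v. \<forall>j<q i. \<bar>v j - xs i j\<bar> \<le> radius}"
  have K: "compact K" unfolding K_def by (rule compact_vecs_cube[OF \<Omega>_closed[OF i] \<Omega>_sub[OF i]])
  have KU: "K \<subseteq> U i" unfolding K_def using \<Omega>_U[OF i] by auto
  obtain G where G: "\<forall>v\<in>K. \<forall>g\<in>subdiff (q i) (U i) (f i) v. \<forall>k<q i. \<bar>g k\<bar> \<le> G"
    using subdiff_bounded_on_compact[OF U_open[OF i] f_strict[OF i] K KU] by blast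
  \<comment> \<open>One contribution each for \<open>x\<close>, the subgradient and
    \<open>W\<^sup>T lam\<close>.\<close>
  define C where "C = \<bar>xs i k\<bar> + radius + G + (\<Sum>r<m. \<bar>W i r k\<bar> * (\<bar>\<mu> r\<bar> + radius))"
  show ?thesis
  proof (rule relaxation_bounded[OF ac_y[OF i k], where C = C])
    show "AE t in lborel. t > 0 \<longrightarrow> (\<exists>e. \<bar>e\<bar> \<le> C \<and> ((\<lambda>t. y t i k) has_real_derivative - y t i k + e) (at t))"
      using dyn
    proof eventually_elim
      case (elim t)
      show ?case
      proof
        assume t: "t > 0"
        then obtain g where g: "g \<in> subdiff (q i) (U i) (f i) (x t i)" and
          dy: "((\<lambda>s. y s i k) has_real_derivative
                 (- y t i k + x t i k - g k + matT_vec m (q i) (W i) (lam t i) k)) (at t)"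
          using elim i k by blast
        have "x t i \<in> K" unfolding K_def using x_mem[of t i] deviations_le_radius(1)[of t i] t i by auto
        then have gk: "\<bar>g k\<bar> \<le> G" using G g k by blast
        have xk: "\<bar>x t i k\<bar> \<le> \<bar>xs i k\<bar> + radius" using deviations_le_radius(1)[of t i k] t i k by linarith
        have "\<bar>matT_vec m (q i) (W i) (lam t i) k\<bar> \<le> (\<Sum>r<m. \<bar>W i r k * lam t i r\<bar>)"
          using k by (simp add: matT_vec_def sum_abs)
        also have "\<dots> \<le> (\<Sum>r<m. \<bar>W i r k\<bar> * (\<bar>\<mu> r\<bar> + radius))"
        proof (rule sum_mono)
          fix r assume "r \<in> {..<m}"
          then have "\<bar>lam t i r\<bar> \<le> \<bar>\<mu> r\<bar> + radius" using deviations_le_radius(2)[of t i r] t i by force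
          then show "\<bar>W i r k * lam t i r\<bar> \<le> \<bar>W i r k\<bar> * (\<bar>\<mu> r\<bar> + radius)"
            unfolding abs_mult by (rule mult_left_mono) simp
        qed
        finally have "\<bar>x t i k - g k + matT_vec m (q i) (W i) (lam t i) k\<bar> \<le> C"
          unfolding C_def using gk xk by linarith
        then show "\<exists>e. \<bar>e\<bar> \<le> C \<and> ((\<lambda>t. y t i k) has_real_derivative - y t i k + e) (at t)"
          using dy by (intro exI[of _ "x t i k - g k + matT_vec m (q i) (W i) (lam t i) k"])
            (simp add: algebra_simps)
      qed
    qed
  qed
qed

lemma x_lipschitz:
  assumes i: "i < n" and k: "k < q i"
  shows "\<exists>L>0. \<forall>s\<ge>0. \<forall>t\<ge>0. \<bar>x t i k - x s i k\<bar> \<le> L * \<bar>t - s\<bar>"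
proof -
  obtain B where B: "\<And>k s t. k < q i \<Longrightarrow> s \<ge> 0 \<Longrightarrow> t \<ge> 0 \<Longrightarrow> \<bar>y t i k - y s i k\<bar> \<le> B k * \<bar>t - s\<bar>"
    using y_bounded_lipschitz[OF i] by metis
  \<comment> \<open>The added 1 makes \<open>L\<close> positive, as it becomes a divisor in the
    choice of a time span.\<close>
  define L where "L = \<bar>\<Sum>k<q i. B k\<bar> + 1"
  have "\<bar>x t i k - x s i k\<bar> \<le> L * \<bar>t - s\<bar>" if st: "s \<ge> 0" "t \<ge> 0" for s t
  proof -
    have "\<bar>x t i k - x s i k\<bar> \<le> (\<Sum>k<q i. \<bar>y t i k - y s i k\<bar>)"
      by (rule is_proj_coordinate_le[OF \<Omega>_convex[OF i] sol_proj[OF st(1) i] sol_proj[OF st(2) i] k])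
    also have "\<dots> \<le> (\<Sum>k<q i. B k * \<bar>t - s\<bar>)" using B st by (intro sum_mono) auto
    also have "\<dots> = (\<Sum>k<q i. B k) * \<bar>t - s\<bar>" by (simp add: sum_distrib_right)
    also have "\<dots> \<le> L * \<bar>t - s\<bar>" unfolding L_def by (intro mult_right_mono) auto
    finally show ?thesis .
  qed
  then show ?thesis by (intro exI[of _ L]) (auto simp: L_def)
qed

theorem bounded_trajectory:
  "\<exists>B. \<forall>t\<ge>0. \<forall>i<n. vnorm (q i) (y t i) \<le> B \<and> vnorm (q i) (x t i) \<le> B \<and>
    vnorm m (lam t i) \<le> B \<and> vnorm m (z t i) \<le> B"
proof -
  have "\<exists>B. \<forall>t\<ge>0. \<forall>i<n. vnorm (q i) (y t i) \<le> B"
    by (rule vnorm_uniformly_bounded) (use y_bounded_lipschitz in blast)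
  moreover have "\<exists>B. \<forall>t\<ge>0. \<bar>x t i k\<bar> \<le> B" if "i < n" "k < q i" for i k
    using deviations_le_radius(1) that by (intro exI[of _ "\<bar>xs i k\<bar> + radius"]) fastforce
  then have "\<exists>B. \<forall>t\<ge>0. \<forall>i<n. vnorm (q i) (x t i) \<le> B"
    by (rule vnorm_uniformly_bounded)
  moreover have "\<exists>B. \<forall>t\<ge>0. \<bar>lam t i r\<bar> \<le> B" if "i < n" "r < m" for i r
    using deviations_le_radius(2) that by (intro exI[of _ "\<bar>\<mu> r\<bar> + radius"]) fastforce
  then have "\<exists>B. \<forall>t\<ge>0. \<forall>i<n. vnorm m (lam t i) \<le> B"
    by (rule vnorm_uniformly_bounded)
  moreover have "\<exists>B. \<forall>t\<ge>0. \<bar>z t i r\<bar> \<le> B" if "i < n" "r < m" for i r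
    using deviations_le_radius(3) that by (intro exI[of _ "\<bar>zs i r\<bar> + radius"]) fastforce
  then have "\<exists>B. \<forall>t\<ge>0. \<forall>i<n. vnorm m (z t i) \<le> B"
    by (rule vnorm_uniformly_bounded)
  ultimately obtain B1 B2 B3 B4 where "\<forall>t\<ge>0. \<forall>i<n. vnorm (q i) (y t i) \<le> B1"
    "\<forall>t\<ge>0. \<forall>i<n. vnorm (q i) (x t i) \<le> B2" "\<forall>t\<ge>0. \<forall>i<n. vnorm m (lam t i) \<le> B3"
    "\<forall>t\<ge>0. \<forall>i<n. vnorm m (z t i) \<le> B4" by blast
  then show ?thesis
    by (intro exI[of _ "max (max B1 B2) (max B3 B4)"]) (auto simp: le_max_iff_disj)
qed

text \<open>Each time \<open>x\<close> is far from \<open>xs\<close> it stays so for a fixed time span, by the Lipschitz bound,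
  and the Lyapunov function drops by a fixed amount; this can happen only finitely often.\<close>

theorem trajectory_tendsto:
  assumes i: "i < n" and k: "k < q i"
  shows "((\<lambda>t. x t i k) \<longlongrightarrow> xs i k) at_top"
proof (rule tendstoI)
  fix \<epsilon> :: real assume \<epsilon>: "\<epsilon> > 0"
  obtain L where L: "L > 0" "\<And>s t. s \<ge> 0 \<Longrightarrow> t \<ge> 0 \<Longrightarrow> \<bar>x t i k - x s i k\<bar> \<le> L * \<bar>t - s\<bar>"
    using x_lipschitz[OF i k] by blast
  \<comment> \<open>Within time \<open>\<tau>\<close> the coordinate moves at most
    \<open>\<epsilon> / 2\<close>, so a deviation of \<open>\<epsilon>\<close> remains at least
    \<open>\<epsilon> / 2\<close>.\<close>
  define \<tau> where "\<tau> = \<epsilon> / (2 * L)"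
  have \<tau>: "\<tau> > 0" "L * \<tau> = \<epsilon> / 2" unfolding \<tau>_def using \<epsilon> L by auto
  define K where "K = (\<Omega> i \<inter> {v. \<forall>j<q i. \<bar>v j - xs i j\<bar> \<le> radius}) \<inter> {v. \<epsilon> / 2 \<le> \<bar>v k - xs i k\<bar>}"
  have K: "compact K" unfolding K_def
  proof (rule compact_Int_closed)
    show "compact (\<Omega> i \<inter> {v. \<forall>j<q i. \<bar>v j - xs i j\<bar> \<le> radius})"
      by (rule compact_vecs_cube[OF \<Omega>_closed[OF i] \<Omega>_sub[OF i]])
    show "closed {v :: nat \<Rightarrow> real. \<epsilon> / 2 \<le> \<bar>v k - xs i k\<bar>}"
      by (intro closed_Collect_le continuous_intros) auto
  qed
  have KU: "K \<subseteq> U i" unfolding K_def using \<Omega>_U[OF i] by auto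
  have pos: "f i v - (\<Sum>k<q i. matT_vec m (q i) (W i) \<mu> k * v k)
      > f i (xs i) - (\<Sum>k<q i. matT_vec m (q i) (W i) \<mu> k * xs i k)" if "v \<in> K" for v
  proof -
    have "v \<noteq> xs i" using that \<epsilon> unfolding K_def by auto
    then show ?thesis using gap_pos[OF i, of v] that unfolding K_def gap_def by auto
  qed
  obtain c where c0: "c > 0" and c1: "\<forall>v\<in>K. f i v - (\<Sum>k<q i. matT_vec m (q i) (W i) \<mu> k * v k)
      \<ge> f i (xs i) - (\<Sum>k<q i. matT_vec m (q i) (W i) \<mu> k * xs i k) + c"
    using tilted_strict_convex_bounded_below_on_compact[OF U_open[OF i] f_strict[OF i] K KU pos] by blast
  have c: "gap i v \<ge> c" if "v \<in> K" for v
    using bspec[OF c1 that] unfolding gap_def by linarith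
  have drop: "lyap (t + \<tau>) \<le> lyap t - c * \<tau>" if t: "t \<ge> 0" and far: "\<bar>x t i k - xs i k\<bar> \<ge> \<epsilon>" for t
  proof -
    have "lyap (t + \<tau>) \<le> lyap t - c * ((t + \<tau>) - t)"
    proof (rule lyap_decrease[OF t])
      fix r assume r: "t < r" "r < t + \<tau>"
      have "\<bar>x r i k - x t i k\<bar> \<le> L * \<bar>r - t\<bar>" using L(2)[of t r] t r by simp
      also have "\<dots> \<le> L * \<tau>" using r L(1) by (intro mult_left_mono) auto
      finally have "\<epsilon> / 2 \<le> \<bar>x r i k - xs i k\<bar>" using far \<tau>(2) by linarith
      then have "x r i \<in> K" unfolding K_def
        using x_mem[of r i] deviations_le_radius(1)[of r i] t r i by auto
      then have "c \<le> gap i (x r i)" by (rule c)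
      also have "\<dots> \<le> (\<Sum>i<n. gap i (x r i))"
        using i t r x_mem[of r] gap_nonneg by (intro member_le_sum) auto
      finally show "c \<le> (\<Sum>i<n. gap i (x r i))" .
    qed (use \<tau> in simp)
    then show ?thesis by simp
  qed
  show "\<forall>\<^sub>F t in at_top. dist (x t i k) (xs i k) < \<epsilon>"
  proof (rule ccontr)
    assume "\<not> ?thesis"
    then have often: "\<exists>t\<ge>T. \<bar>x t i k - xs i k\<bar> \<ge> \<epsilon>" for T
      by (auto simp: eventually_at_top_linorder dist_real_def not_less)
    \<comment> \<open>Each new far time is sought past the end of the previous span, so the spans do
      not overlap and the drops add up.\<close>
    have "\<exists>t\<ge>0. lyap t \<le> lyap 0 - real N * (c * \<tau>)" for N
    proof (induction N)
      case 0
      then show ?case by auto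
    next
      case (Suc N)
      then obtain t where t: "t \<ge> 0" "lyap t \<le> lyap 0 - real N * (c * \<tau>)" by blast
      obtain t' where t': "t' \<ge> t" "\<bar>x t' i k - xs i k\<bar> \<ge> \<epsilon>" using often by blast
      have "lyap (t' + \<tau>) \<le> lyap t' - c * \<tau>" using drop t t' by auto
      also have "\<dots> \<le> lyap t - c * \<tau>" using lyap_antimono[of t t'] t t' by simp
      also have "\<dots> \<le> lyap 0 - real (Suc N) * (c * \<tau>)" using t by (simp add: algebra_simps)
      finally show ?case using t t' \<tau> by (intro exI[of _ "t' + \<tau>"]) auto
    qed
    moreover obtain N where N: "lyap 0 < real N * (c * \<tau>)"
      using reals_Archimedean3[of "c * \<tau>"] c0 \<tau> by auto
    ultimately obtain t where "t \<ge> 0" "lyap t \<le> lyap 0 - real N * (c * \<tau>)" by blast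
    with N show False using lyap_nonneg[of t] by linarith
  qed
qed

end

subsection \<open>Existence of multipliers\<close>

lemma sum_fun_upd:
  fixes g :: "nat \<Rightarrow> 'a \<Rightarrow> real"
  assumes "i < n"
  shows "(\<Sum>l<n. g l ((v(i := w)) l)) = (\<Sum>l<n. g l (v l)) + (g i w - g i (v i))"
proof -
  have "(\<Sum>l\<in>{..<n} - {i}. g l ((v(i := w)) l)) = (\<Sum>l\<in>{..<n} - {i}. g l (v l))"
    by (intro sum.cong) auto
  then show ?thesis
    using assms by (simp add: sum.remove[of "{..<n}" i])
qed

text \<open>A short step from the interior point \<open>x0\<close> away from \<open>u\<close> stays
  in every \<open>\<Omega> i\<close>. Since \<open>x0\<close> satisfies the affine constraints,
  their residuals at the new point are \<open>-c\<close> times those at \<open>u\<close>.\<close>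

lemma slater_reflection:
  fixes n :: nat and q :: "nat \<Rightarrow> nat"
  assumes x0: "\<And>i. i < n \<Longrightarrow> x0 i \<in> (top_of_set (vecs (q i))) interior_of (\<Omega> i)"
    and u: "\<And>i. i < n \<Longrightarrow> u i \<in> vecs (q i)"
  shows "\<exists>c>0. \<forall>i<n. (\<lambda>k. x0 i k - c * (u i k - x0 i k)) \<in> \<Omega> i"
proof -
  have "\<forall>i. \<exists>e>0. i < n \<longrightarrow> (\<forall>v\<in>vecs (q i). (\<forall>j<q i. \<bar>v j - x0 i j\<bar> \<le> e) \<longrightarrow> v \<in> \<Omega> i)"
  proof
    fix i
    show "\<exists>e>0. i < n \<longrightarrow> (\<forall>v\<in>vecs (q i). (\<forall>j<q i. \<bar>v j - x0 i j\<bar> \<le> e) \<longrightarrow> v \<in> \<Omega> i)"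
    proof (cases "i < n")
      case True
      then show ?thesis
        using openin_vecs_contains_cube[OF openin_interior_of x0[OF True]]
          interior_of_subset[of "top_of_set (vecs (q i))" "\<Omega> i"] by (meson subsetD)
    qed (auto intro: exI[of _ 1])
  qed
  then obtain e where e: "\<And>i. e i > 0"
    and cube: "\<And>i v. i < n \<Longrightarrow> v \<in> vecs (q i) \<Longrightarrow> (\<forall>j<q i. \<bar>v j - x0 i j\<bar> \<le> e i) \<Longrightarrow> v \<in> \<Omega> i"
    by metis
  \<comment> \<open>Dominates every coordinate of \<open>u i - x0 i\<close>, with 1 added to permit
    division; a step \<open>c \<le> e i / S i\<close> then stays in the cube of radius
    \<open>e i\<close>.\<close>
  define S where "S i = 1 + (\<Sum>j<q i. \<bar>u i j - x0 i j\<bar>)" for i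
  have S: "S i > 0" for i unfolding S_def by (simp add: add_pos_nonneg sum_nonneg)
  define c where "c = Min (insert 1 ((\<lambda>i. e i / S i) ` {..<n}))"
  have pos: "0 < e i / S i" for i using e S by simp
  have "c \<in> insert 1 ((\<lambda>i. e i / S i) ` {..<n})" unfolding c_def by (rule Min_in) auto
  then obtain l where "c = 1 \<or> c = e l / S l" by blast
  then have "c > 0" using pos[of l] by (metis zero_less_one)
  show ?thesis
  proof (intro exI[of _ c] conjI \<open>c > 0\<close> allI impI)
    fix i assume i: "i < n"
    have x0q: "x0 i \<in> vecs (q i)"
      using x0[OF i] interior_of_subset_topspace[of "top_of_set (vecs (q i))" "\<Omega> i"] by auto
    show "(\<lambda>k. x0 i k - c * (u i k - x0 i k)) \<in> \<Omega> i"
    proof (rule cube[OF i])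
      show "(\<lambda>k. x0 i k - c * (u i k - x0 i k)) \<in> vecs (q i)"
        using u[OF i] x0q by (auto simp: vecs_def)
      show "\<forall>j<q i. \<bar>x0 i j - c * (u i j - x0 i j) - x0 i j\<bar> \<le> e i"
      proof (intro allI impI)
        fix j assume j: "j < q i"
        have "\<bar>u i j - x0 i j\<bar> \<le> S i"
          using member_le_sum[of j "{..<q i}" "\<lambda>j. \<bar>u i j - x0 i j\<bar>"] j unfolding S_def by force
        moreover have "c \<le> e i / S i" unfolding c_def using i by (intro Min_le) auto
        ultimately have "c * \<bar>u i j - x0 i j\<bar> \<le> e i / S i * S i"
          using \<open>c > 0\<close> e[of i] S[of i] by (intro mult_mono) auto
        also have "\<dots> = e i" using S[of i] by simp
        finally show "\<bar>x0 i j - c * (u i j - x0 i j) - x0 i j\<bar> \<le> e i"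
          using \<open>c > 0\<close> by (simp add: abs_mult)
      qed
    qed
  qed
qed

text \<open>The abstract multiplier inequality concerns all blocks at once. Replacing a single block
  of \<open>xs\<close> decouples it: the residuals vanish at \<open>xs\<close>, so only the
  contribution of that block survives.\<close>

lemma optimal_multiplier:
  assumes \<Omega>_sub: "\<And>i. i < n \<Longrightarrow> \<Omega> i \<subseteq> vecs (q i)"
    and \<Omega>_convex: "\<And>i. i < n \<Longrightarrow> convex_vec (\<Omega> i)"
    and \<Omega>_U: "\<And>i. i < n \<Longrightarrow> \<Omega> i \<subseteq> U i"
    and f_strict: "\<And>i. i < n \<Longrightarrow> strict_convex_vec_on (U i) (f i)"
    and x0: "\<And>i. i < n \<Longrightarrow> x0 i \<in> (top_of_set (vecs (q i))) interior_of (\<Omega> i)"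
    and x0_eq: "\<And>r. r < m \<Longrightarrow> (\<Sum>i<n. mat_vec m (q i) (W i) (x0 i) r) = (\<Sum>i<n. d i r)"
    and opt: "optimal n m q \<Omega> f W d xs"
  shows "\<exists>\<mu>. \<forall>i<n. \<forall>u\<in>\<Omega> i.
        f i (xs i) - (\<Sum>k<q i. matT_vec m (q i) (W i) \<mu> k * xs i k)
        \<le> f i u - (\<Sum>k<q i. matT_vec m (q i) (W i) \<mu> k * u k)"
proof -
  define X where "X = {u :: nat \<Rightarrow> nat \<Rightarrow> real. \<forall>i<n. u i \<in> \<Omega> i}"
  define F where "F u = (\<Sum>i<n. f i (u i))" for u
  define \<phi> where "\<phi> r u = (\<Sum>i<n. \<Sum>k<q i. W i r k * u i k) - (\<Sum>i<n. d i r)" for r and u :: "nat \<Rightarrow> nat \<Rightarrow> real"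
  have mv: "(\<Sum>i<n. mat_vec m (q i) (W i) (u i) r) = (\<Sum>i<n. \<Sum>k<q i. W i r k * u i k)" if "r < m" for u r
    using that by (simp add: mat_vec_def)
  have xs0: "\<phi> r xs = 0" if "r < m" for r
    using opt that mv unfolding \<phi>_def optimal_def feasible_def by auto
  have xsX: "xs \<in> X" using opt unfolding X_def optimal_def feasible_def by auto
  have \<phi>_affine: "\<phi> r (\<lambda>i k. s * u i k + (1 - s) * v i k) = s * \<phi> r u + (1 - s) * \<phi> r v" for r s u v
  proof -
    have "(\<Sum>i<n. \<Sum>k<q i. W i r k * (s * u i k + (1 - s) * v i k))
       = s * (\<Sum>i<n. \<Sum>k<q i. W i r k * u i k) + (1 - s) * (\<Sum>i<n. \<Sum>k<q i. W i r k * v i k)"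
      unfolding sum_distrib_left sum.distrib[symmetric]
      by (intro sum.cong) (auto simp: distrib_left mult.left_commute)
    then show ?thesis unfolding \<phi>_def by (simp add: algebra_simps)
  qed
  have "\<exists>\<mu>. \<forall>u\<in>X. F xs \<le> F u - (\<Sum>r<m. \<mu> r * \<phi> r u)"
  proof (rule lagrange_multipliers_exist)
    fix u v :: "nat \<Rightarrow> nat \<Rightarrow> real" and s :: real assume uv: "u \<in> X" "v \<in> X" "0 < s" "s < 1"
    show "\<exists>w\<in>X. F w \<le> s * F u + (1 - s) * F v \<and> (\<forall>r<m. \<phi> r w = s * \<phi> r u + (1 - s) * \<phi> r v)"
    proof (intro bexI[of _ "\<lambda>i k. s * u i k + (1 - s) * v i k"] conjI allI impI \<phi>_affine)
      show "(\<lambda>i k. s * u i k + (1 - s) * v i k) \<in> X"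
        using uv \<Omega>_convex unfolding X_def convex_vec_def by simp
      have "F (\<lambda>i k. s * u i k + (1 - s) * v i k) \<le> (\<Sum>i<n. s * f i (u i) + (1 - s) * f i (v i))"
        unfolding F_def
      proof (rule sum_mono)
        fix i assume i: "i \<in> {..<n}"
        then have "u i \<in> U i" "v i \<in> U i" using uv \<Omega>_U unfolding X_def by auto
        then show "f i (\<lambda>k. s * u i k + (1 - s) * v i k) \<le> s * f i (u i) + (1 - s) * f i (v i)"
          using strict_convex_vec_on_imp_le[OF f_strict] i uv by auto
      qed
      then show "F (\<lambda>i k. s * u i k + (1 - s) * v i k) \<le> s * F u + (1 - s) * F v"
        by (simp add: F_def sum.distrib sum_distrib_left)
    qed
  next
    fix u assume u: "u \<in> X"
    have "u i \<in> vecs (q i)" if "i < n" for i using u \<Omega>_sub[OF that] that unfolding X_def by auto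
    from slater_reflection[where \<Omega> = \<Omega>, OF x0 this]
    obtain c where c: "c > 0" "\<And>i. i < n \<Longrightarrow> (\<lambda>k. x0 i k - c * (u i k - x0 i k)) \<in> \<Omega> i" by blast
    \<comment> \<open>The reflection is an affine combination with the negative weight
      \<open>-c\<close>, which \<open>\<phi>_affine\<close> permits.\<close>
    have eq: "(\<lambda>i k. x0 i k - c * (u i k - x0 i k)) = (\<lambda>i k. (- c) * u i k + (1 - (- c)) * x0 i k)"
      by (auto simp: algebra_simps)
    show "\<exists>v\<in>X. \<exists>c>0. \<forall>r<m. \<phi> r v = - c * \<phi> r u"
    proof (intro bexI[of _ "\<lambda>i k. x0 i k - c * (u i k - x0 i k)"] exI[of _ c] conjI c(1) allI impI)
      fix r assume "r < m"
      then have "\<phi> r x0 = 0" using x0_eq mv unfolding \<phi>_def by simp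
      then show "\<phi> r (\<lambda>i k. x0 i k - c * (u i k - x0 i k)) = - c * \<phi> r u"
        unfolding eq \<phi>_affine by simp
    qed (use c(2) in \<open>simp add: X_def\<close>)
  next
    fix u assume "u \<in> X" "\<forall>r<m. \<phi> r u = 0"
    then have "feasible n m q \<Omega> W d u"
      unfolding feasible_def X_def \<phi>_def by (auto simp: mv)
    then show "F xs \<le> F u" using opt unfolding optimal_def F_def by blast
  qed
  then obtain \<mu> where \<mu>: "\<And>u. u \<in> X \<Longrightarrow> F xs \<le> F u - (\<Sum>r<m. \<mu> r * \<phi> r u)" by blast
  have "f i (xs i) - (\<Sum>k<q i. matT_vec m (q i) (W i) \<mu> k * xs i k)
        \<le> f i u - (\<Sum>k<q i. matT_vec m (q i) (W i) \<mu> k * u k)" if i: "i < n" and u: "u \<in> \<Omega> i" for i u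
  proof -
    have "xs(i := u) \<in> X" using xsX u unfolding X_def by auto
    from \<mu>[OF this] have "F xs \<le> F (xs(i := u)) - (\<Sum>r<m. \<mu> r * \<phi> r (xs(i := u)))" .
    moreover have "F (xs(i := u)) = F xs + (f i u - f i (xs i))"
      unfolding F_def by (rule sum_fun_upd[OF i, of f])
    moreover have "(\<Sum>r<m. \<mu> r * \<phi> r (xs(i := u))) =
        (\<Sum>k<q i. matT_vec m (q i) (W i) \<mu> k * u k) - (\<Sum>k<q i. matT_vec m (q i) (W i) \<mu> k * xs i k)"
      unfolding matT_vec_pairing sum_subtractf[symmetric]
    proof (intro sum.cong refl)
      fix r assume "r \<in> {..<m}"
      then have r: "r < m" by simp
      have "\<phi> r (xs(i := u)) = \<phi> r xs + ((\<Sum>k<q i. W i r k * u k) - (\<Sum>k<q i. W i r k * xs i k))"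
        unfolding \<phi>_def
        using sum_fun_upd[OF i, of "\<lambda>i v. \<Sum>k<q i. W i r k * v k" xs u] by simp
      then show "\<mu> r * \<phi> r (xs(i := u)) = \<mu> r * (\<Sum>k<q i. W i r k * u k) - \<mu> r * (\<Sum>k<q i. W i r k * xs i k)"
        using xs0[OF r] by (simp add: right_diff_distrib)
    qed
    ultimately show ?thesis by linarith
  qed
  then show ?thesis by blast
qed

theorem theorem2:
  fixes n m :: nat and q :: "nat \<Rightarrow> nat"
    and a :: "nat \<Rightarrow> nat \<Rightarrow> real"
    and \<Omega> U :: "nat \<Rightarrow> (nat \<Rightarrow> real) set"
    and f :: "nat \<Rightarrow> (nat \<Rightarrow> real) \<Rightarrow> real"
    and W :: "nat \<Rightarrow> nat \<Rightarrow> nat \<Rightarrow> real"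
    and d :: "nat \<Rightarrow> nat \<Rightarrow> real"
    and y x lam z :: "real \<Rightarrow> nat \<Rightarrow> nat \<Rightarrow> real"
  assumes a_sym: "\<And>i j. a i j = a j i"
    and a_nonneg: "\<And>i j. a i j \<ge> 0"
    and conn: "graph_connected n a"
    and \<Omega>_sub: "\<And>i. i < n \<Longrightarrow> \<Omega> i \<subseteq> vecs (q i)"
    and \<Omega>_closed: "\<And>i. i < n \<Longrightarrow> closed (\<Omega> i)"
    and \<Omega>_convex: "\<And>i. i < n \<Longrightarrow> convex_vec (\<Omega> i)"
    and U_open: "\<And>i. i < n \<Longrightarrow> openin (top_of_set (vecs (q i))) (U i)"
    and U_convex: "\<And>i. i < n \<Longrightarrow> convex_vec (U i)"
    and \<Omega>_U: "\<And>i. i < n \<Longrightarrow> \<Omega> i \<subseteq> U i"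
    and f_strict: "\<And>i. i < n \<Longrightarrow> strict_convex_vec_on (U i) (f i)"
    and d_vec: "\<And>i. i < n \<Longrightarrow> d i \<in> vecs m"
    and slater: "\<exists>xs. (\<forall>i<n. xs i \<in> (top_of_set (vecs (q i))) interior_of (\<Omega> i)) \<and>
                   (\<forall>r<m. (\<Sum>i<n. mat_vec m (q i) (W i) (xs i) r) = (\<Sum>i<n. d i r))"
    and opt_exists: "\<exists>xs. optimal n m q \<Omega> f W d xs"
    and sol_space: "\<And>t i. t \<ge> 0 \<Longrightarrow> i < n \<Longrightarrow>
          y t i \<in> vecs (q i) \<and> lam t i \<in> vecs m \<and> z t i \<in> vecs m"
    and sol_proj: "\<And>t i. t \<ge> 0 \<Longrightarrow> i < n \<Longrightarrow> is_proj (q i) (\<Omega> i) (y t i) (x t i)"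
    and ac_y: "\<And>i k. i < n \<Longrightarrow> k < q i \<Longrightarrow> abs_cont_nonneg (\<lambda>t. y t i k)"
    and ac_lam: "\<And>i r. i < n \<Longrightarrow> r < m \<Longrightarrow> abs_cont_nonneg (\<lambda>t. lam t i r)"
    and ac_z: "\<And>i r. i < n \<Longrightarrow> r < m \<Longrightarrow> abs_cont_nonneg (\<lambda>t. z t i r)"
    and dyn: "AE t in lborel. t > 0 \<longrightarrow> (\<forall>i<n.
          (\<exists>g\<in>subdiff (q i) (U i) (f i) (x t i). \<forall>k<q i.
              ((\<lambda>s. y s i k) has_real_derivative
                 (- y t i k + x t i k - g k + matT_vec m (q i) (W i) (lam t i) k)) (at t)) \<and>
          (\<forall>r<m. ((\<lambda>s. lam s i r) has_real_derivative
                 (d i r - mat_vec m (q i) (W i) (x t i) r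
                  - (\<Sum>j<n. a i j * (lam t i r - lam t j r))
                  - (\<Sum>j<n. a i j * (z t i r - z t j r)))) (at t)) \<and>
          (\<forall>r<m. ((\<lambda>s. z s i r) has_real_derivative
                 (\<Sum>j<n. a i j * (lam t i r - lam t j r))) (at t)))"
  shows "(\<exists>B. \<forall>t\<ge>0. \<forall>i<n. vnorm (q i) (y t i) \<le> B \<and> vnorm (q i) (x t i) \<le> B \<and>
                          vnorm m (lam t i) \<le> B \<and> vnorm m (z t i) \<le> B) \<and>
         (\<forall>xs. optimal n m q \<Omega> f W d xs \<longrightarrow>
            (\<forall>i<n. \<forall>k<q i. ((\<lambda>t. x t i k) \<longlongrightarrow> xs i k) at_top))"
proof -
  obtain x0 where x0: "\<And>i. i < n \<Longrightarrow> x0 i \<in> (top_of_set (vecs (q i))) interior_of (\<Omega> i)"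
    "\<And>r. r < m \<Longrightarrow> (\<Sum>i<n. mat_vec m (q i) (W i) (x0 i) r) = (\<Sum>i<n. d i r)"
    using slater by blast
  \<comment> \<open>Stated for every optimal point: boundedness takes any one of them, while
    convergence is claimed towards an arbitrary one.\<close>
  have flow: "\<exists>\<mu> zs. saddle_flow n m q a \<Omega> U f W d y x lam z xs \<mu> zs"
    if opt: "optimal n m q \<Omega> f W d xs" for xs
  proof -
    obtain \<mu> where \<mu>: "\<And>i u. i < n \<Longrightarrow> u \<in> \<Omega> i \<Longrightarrow>
        f i (xs i) - (\<Sum>k<q i. matT_vec m (q i) (W i) \<mu> k * xs i k)
        \<le> f i u - (\<Sum>k<q i. matT_vec m (q i) (W i) \<mu> k * u k)"
      using optimal_multiplier[OF \<Omega>_sub \<Omega>_convex \<Omega>_U f_strict x0 opt] by blast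
    have feas: "\<And>i. i < n \<Longrightarrow> xs i \<in> \<Omega> i"
      "\<And>r. r < m \<Longrightarrow> (\<Sum>i<n. d i r - mat_vec m (q i) (W i) (xs i) r) = 0"
      using opt unfolding optimal_def feasible_def by (auto simp: sum_subtractf)
    \<comment> \<open>Feasibility of \<open>xs\<close> is precisely the zero-sum condition for
      solvability, one Laplacian system per constraint coordinate.\<close>
    have "\<forall>r. \<exists>v. r < m \<longrightarrow> (\<forall>i<n. laplacian n a v i = d i r - mat_vec m (q i) (W i) (xs i) r)"
      using laplacian_solvable[OF a_sym a_nonneg conn feas(2)] by blast
    then obtain v where v: "\<And>i r. i < n \<Longrightarrow> r < m \<Longrightarrow>
        laplacian n a (v r) i = d i r - mat_vec m (q i) (W i) (xs i) r" by metis
    define zs where "zs i r = v r i" for i r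
    have zs: "laplacian n a (\<lambda>j. zs j r) i = d i r - mat_vec m (q i) (W i) (xs i) r"
      if "i < n" "r < m" for i r
      unfolding zs_def using v[OF that] .
    have "saddle_flow n m q a \<Omega> U f W d y x lam z xs \<mu> zs"
      by (rule saddle_flow.intro, unfold laplacian_def)
        (fact a_sym a_nonneg \<Omega>_sub \<Omega>_closed \<Omega>_convex U_open \<Omega>_U f_strict sol_proj ac_y ac_lam ac_z
          dyn feas(1) \<mu> zs[unfolded laplacian_def])+
    then show ?thesis by blast
  qed
  show ?thesis
  proof (intro conjI allI impI)
    obtain xs where "optimal n m q \<Omega> f W d xs" using opt_exists by blast
    then obtain \<mu> zs where "saddle_flow n m q a \<Omega> U f W d y x lam z xs \<mu> zs" using flow by blast
    then show "\<exists>B. \<forall>t\<ge>0. \<forall>i<n. vnorm (q i) (y t i) \<le> B \<and> vnorm (q i) (x t i) \<le> B \<and>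
        vnorm m (lam t i) \<le> B \<and> vnorm m (z t i) \<le> B"
      by (rule saddle_flow.bounded_trajectory)
  next
    fix xs i k assume opt: "optimal n m q \<Omega> f W d xs" and ik: "i < n" "k < q i"
    obtain \<mu> zs where "saddle_flow n m q a \<Omega> U f W d y x lam z xs \<mu> zs" using flow[OF opt] by blast
    then show "((\<lambda>t. x t i k) \<longlongrightarrow> xs i k) at_top"
      using ik by (rule saddle_flow.trajectory_tendsto)
  qed
qed

end
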